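(* For each $n\geq 1$ let $X_n$ and $Y_n$ be independent random variables, each following the uniform law on the finite set $\{z\in Z' : N(z)\le n^2\}$. Let $Z_n=X_n\wedge Y_n$. Then $Z_n$ converges in law to $\zeta'_2$ as $n\to+\infty$. In particular, $$\lim_{n\to+\infty}\mathbb{P}(X_n\wedge Y_n=1)=\left(\sum_{z\in Z'}N(z)^{-2}\right)^{-1}=\frac{1}{\zeta(2)\beta(2)}.$$
   Context: $\mathbb{Z}[i]=\{a+ib : a,b\in\mathbb{Z}\}$ is the ring of Gaussian integers and $N(z)=z\overline{z}$. $Z'$ denotes the set of nonzero classes of $\mathbb{Z}[i]$ modulo multiplication by the units $1,i,-1,-i$ (i.e. nonzero Gaussian integers up to associates); each class has a unique representative $a+ib$ with $a\ge0$, $b>0$. Multiplication, divisibility and the norm $N$ pass to the quotient $Z'$; $x\wedge y$ denotes the greatest common divisor of $x,y\in Z'$, which is a well-defined element of $Z'$ since $\mathbb{Z}[i]$ is factorial, and $1\in Z'$ denotes the class of the units. For $s>1$, the series $\sum_{z\in Z'}N(z)^{-s}$ converges, and $\zeta'_s$ is the probability on $Z'$ defined by $\zeta'_s(x)=\left(\sum_{z\in Z'}N(z)^{-s}\right)^{-1}N(x)^{-s}$. Here $\zeta(s)=\sum_{k=1}^{+\infty}k^{-s}$ and $\beta(s)=\sum_{n=0}^{+\infty}\frac{(-1)^n}{(2n+1)^s}$. Random variables $Z_n$ with values in a countable set $\Omega$ converge in law to a probability $P$ on $\Omega$ if $\mathbb{P}(Z_n=x)\to P(\{x\})$ for every $x\in\Omega$.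 *)

theory Defs
  imports "HOL-Probability.Probability"
begin

text \<open>
  Gaussian integers form a subset of the complex numbers; the type \<open>gclass\<close> below is the set of
  nonzero Gaussian integers up to associates.
\<close>

definition gauss_ints :: "complex set" where
  "gauss_ints = {Complex (of_int a) (of_int b) |a b. True}"

definition gauss_units :: "complex set" where
  "gauss_units = {1, \<i>, -1, -\<i>}"

definition gauss_assoc :: "complex \<Rightarrow> complex \<Rightarrow> bool" where
  "gauss_assoc x y \<longleftrightarrow>
     x \<in> gauss_ints - {0} \<and> y \<in> gauss_ints - {0} \<and> (\<exists>u\<in>gauss_units. y = u * x)"

lemma gauss_ints_iff: "z \<in> gauss_ints \<longleftrightarrow> Re z \<in> \<int> \<and> Im z \<in> \<int>"
  by (auto simp: gauss_ints_def complex_eq_iff elim!: Ints_cases)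

lemma gauss_ints_mult: "x \<in> gauss_ints \<Longrightarrow> y \<in> gauss_ints \<Longrightarrow> x * y \<in> gauss_ints"
  by (simp add: gauss_ints_iff)

lemma gauss_ints_add: "x \<in> gauss_ints \<Longrightarrow> y \<in> gauss_ints \<Longrightarrow> x + y \<in> gauss_ints"
  by (simp add: gauss_ints_iff)

lemma gauss_ints_diff: "x \<in> gauss_ints \<Longrightarrow> y \<in> gauss_ints \<Longrightarrow> x - y \<in> gauss_ints"
  by (simp add: gauss_ints_iff)

lemma gauss_ints_0: "0 \<in> gauss_ints" and gauss_ints_1: "1 \<in> gauss_ints"
  by (simp_all add: gauss_ints_iff)

lemma gauss_units_in_ints: "u \<in> gauss_units \<Longrightarrow> u \<in> gauss_ints"
  by (auto simp: gauss_units_def gauss_ints_iff)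

lemma gauss_units_mult: "u \<in> gauss_units \<Longrightarrow> v \<in> gauss_units \<Longrightarrow> u * v \<in> gauss_units"
  by (auto simp: gauss_units_def)

lemma gauss_units_norm: "u \<in> gauss_units \<Longrightarrow> u * cnj u = 1"
  by (auto simp: gauss_units_def)

lemma gauss_units_cnj: "u \<in> gauss_units \<Longrightarrow> cnj u \<in> gauss_units"
  by (auto simp: gauss_units_def)

lemma gauss_assoc_refl: "x \<in> gauss_ints - {0} \<Longrightarrow> gauss_assoc x x"
  by (auto simp: gauss_assoc_def gauss_units_def)

text \<open>The relation is partial: its domain is the set of nonzero Gaussian integers.\<close>

quotient_type gclass = complex / partial: gauss_assoc
proof (rule part_equivpI)
  show "\<exists>x. gauss_assoc x x"
    by (rule exI[of _ 1]) (simp add: gauss_assoc_refl gauss_ints_1)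
  show "symp gauss_assoc"
  proof (rule sympI)
    fix x y assume a: "gauss_assoc x y"
    then obtain u where u: "u \<in> gauss_units" "y = u * x" by (auto simp: gauss_assoc_def)
    have "cnj u * y = (u * cnj u) * x" by (simp add: u(2))
    then have "x = cnj u * y" using gauss_units_norm[OF u(1)] by simp
    then show "gauss_assoc y x"
      using a gauss_units_cnj[OF u(1)] unfolding gauss_assoc_def by blast
  qed
  show "transp gauss_assoc"
  proof (rule transpI)
    fix x y z assume a: "gauss_assoc x y" "gauss_assoc y z"
    then obtain u v where "u \<in> gauss_units" "y = u * x" "v \<in> gauss_units" "z = v * y"
      by (auto simp: gauss_assoc_def)
    then have "v * u \<in> gauss_units" "z = v * u * x"
      by (auto intro: gauss_units_mult)
    then show "gauss_assoc x z" using a unfolding gauss_assoc_def by blast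
  qed
qed

text \<open>Divisibility on the quotient is the library's \<^term>\<open>(dvd)\<close>, which is available for any type
  with a multiplication.\<close>

instantiation gclass :: comm_monoid_mult
begin

lift_definition one_gclass :: gclass is 1
  by (simp add: gauss_assoc_refl gauss_ints_1)

lift_definition times_gclass :: "gclass \<Rightarrow> gclass \<Rightarrow> gclass" is "(*)"
proof -
  fix x x' y y' assume a: "gauss_assoc x x'" "gauss_assoc y y'"
  then obtain u v where u: "u \<in> gauss_units" "x' = u * x" "v \<in> gauss_units" "y' = v * y"
    by (auto simp: gauss_assoc_def)
  then have "u * v \<in> gauss_units" "x' * y' = (u * v) * (x * y)"
    by (auto intro: gauss_units_mult)
  then show "gauss_assoc (x * y) (x' * y')"
    using a gauss_ints_mult unfolding gauss_assoc_def
    by (metis DiffD1 DiffD2 DiffI mult_eq_0_iff singleton_iff)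
qed

instance
proof
  fix a b c :: gclass
  show "a * b * c = a * (b * c)"
  proof transfer
    fix a b c assume "gauss_assoc a a" "gauss_assoc b b" "gauss_assoc c c"
    then have "a * b * c \<in> gauss_ints - {0}"
      by (auto simp: gauss_assoc_def intro: gauss_ints_mult)
    then show "gauss_assoc (a * b * c) (a * (b * c))"
      using gauss_assoc_refl by (simp add: mult.assoc)
  qed
  show "a * b = b * a"
  proof transfer
    fix a b assume "gauss_assoc a a" "gauss_assoc b b"
    then have "a * b \<in> gauss_ints - {0}"
      by (auto simp: gauss_assoc_def intro: gauss_ints_mult)
    then show "gauss_assoc (a * b) (b * a)"
      using gauss_assoc_refl by (simp add: mult.commute)
  qed
  show "1 * a = a"
    by transfer simp
qed

end

lift_definition gnorm :: "gclass \<Rightarrow> real" is "\<lambda>z. Re (z * cnj z)"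
proof -
  fix x y assume "gauss_assoc x y"
  then obtain u where u: "u \<in> gauss_units" "y = u * x" by (auto simp: gauss_assoc_def)
  have "y * cnj y = (u * cnj u) * (x * cnj x)" by (simp add: u(2))
  also have "\<dots> = x * cnj x" using gauss_units_norm[OF u(1)] by simp
  finally show "Re (x * cnj x) = Re (y * cnj y)" by simp
qed

lemma gclass_cases:
  obtains z where "z \<in> gauss_ints" "z \<noteq> 0" "x = abs_gclass z"
proof -
  have "gauss_assoc (rep_gclass x) (rep_gclass x)"
    by (rule Quotient_rep_reflp[OF Quotient_gclass])
  moreover have "x = abs_gclass (rep_gclass x)"
    by (simp add: Quotient_abs_rep[OF Quotient_gclass])
  ultimately show ?thesis using that by (auto simp: gauss_assoc_def)
qed

lemma abs_gclass_mult:
  assumes "x \<in> gauss_ints" "x \<noteq> 0" "y \<in> gauss_ints" "y \<noteq> 0"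
  shows "abs_gclass x * abs_gclass y = abs_gclass (x * y)"
  using assms by (simp add: times_gclass.abs_eq gauss_assoc_refl)

lemma gnorm_abs:
  assumes "x \<in> gauss_ints" "x \<noteq> 0"
  shows "gnorm (abs_gclass x) = (cmod x)\<^sup>2"
  using assms cmod_power2[of x]
  by (simp add: gnorm.abs_eq gauss_assoc_refl power2_eq_square)

lemma abs_gclass_eq_iff:
  assumes "x \<in> gauss_ints" "x \<noteq> 0" "y \<in> gauss_ints" "y \<noteq> 0"
  shows "abs_gclass x = abs_gclass y \<longleftrightarrow> (\<exists>u\<in>gauss_units. y = u * x)"
  using Quotient_rel[OF Quotient_gclass, of x y] assms
  by (auto simp: gauss_assoc_refl) (auto simp: gauss_assoc_def)

lemma gclass_dvd_iff:
  assumes "x \<in> gauss_ints" "x \<noteq> 0" "y \<in> gauss_ints" "y \<noteq> 0"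
  shows "abs_gclass x dvd abs_gclass y \<longleftrightarrow> (\<exists>c\<in>gauss_ints. y = x * c)"
proof
  assume "abs_gclass x dvd abs_gclass y"
  then obtain k where k: "abs_gclass y = abs_gclass x * k" by (elim dvdE)
  obtain c where c: "c \<in> gauss_ints" "c \<noteq> 0" "k = abs_gclass c" by (rule gclass_cases)
  have "abs_gclass (x * c) = abs_gclass y"
    using k c assms by (simp add: abs_gclass_mult)
  then obtain u where u: "u \<in> gauss_units" "y = u * (x * c)"
    using abs_gclass_eq_iff[of "x * c" y] assms c gauss_ints_mult by auto
  then have "u * c \<in> gauss_ints" "y = x * (u * c)"
    using c by (auto intro: gauss_ints_mult gauss_units_in_ints)
  then show "\<exists>c\<in>gauss_ints. y = x * c" by blast
next
  assume "\<exists>c\<in>gauss_ints. y = x * c"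
  then obtain c where "c \<in> gauss_ints" "y = x * c" by blast
  then have "abs_gclass y = abs_gclass x * abs_gclass c"
    using assms by (subst abs_gclass_mult) auto
  then show "abs_gclass x dvd abs_gclass y" by (rule dvdI)
qed

lemma gauss_cmod_ge_1:
  assumes "z \<in> gauss_ints" "z \<noteq> 0"
  shows "(cmod z)\<^sup>2 \<ge> 1"
proof -
  obtain a b where z: "z = Complex (of_int a) (of_int b)" using assms by (auto simp: gauss_ints_def)
  have "a\<^sup>2 + b\<^sup>2 > 0" using assms(2) by (simp add: z sum_power2_gt_zero_iff complex_eq_iff)
  then have "a\<^sup>2 + b\<^sup>2 \<ge> 1" by simp
  then have "real_of_int (a\<^sup>2 + b\<^sup>2) \<ge> 1" by linarith
  then show ?thesis by (simp add: z cmod_power2)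
qed

lemma gauss_cmod_eq_1:
  assumes "z \<in> gauss_ints" "(cmod z)\<^sup>2 = 1"
  shows "z \<in> gauss_units"
proof -
  obtain a b where z: "z = Complex (of_int a) (of_int b)" using assms by (auto simp: gauss_ints_def)
  have "real_of_int (a\<^sup>2 + b\<^sup>2) = 1" using assms(2) by (simp add: z cmod_power2)
  then have ab: "a\<^sup>2 + b\<^sup>2 = 1" by linarith
  have "a\<^sup>2 \<le> 1" "b\<^sup>2 \<le> 1" using ab zero_le_power2[of a] zero_le_power2[of b] by linarith+
  then have "\<bar>a\<bar> \<le> 1" "\<bar>b\<bar> \<le> 1" by (simp_all add: abs_square_le_1)
  then have "a \<in> {-1, 0, 1}" "b \<in> {-1, 0, 1}" by auto
  then show ?thesis using ab by (auto simp: z gauss_units_def complex_eq_iff)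
qed

lemma gnorm_ge_1: "gnorm x \<ge> 1"
  by (rule gclass_cases[of x]) (simp add: gnorm_abs gauss_cmod_ge_1)

lemma gnorm_mult: "gnorm (x * y) = gnorm x * gnorm y"
proof -
  obtain a where a: "a \<in> gauss_ints" "a \<noteq> 0" "x = abs_gclass a" by (rule gclass_cases)
  obtain b where b: "b \<in> gauss_ints" "b \<noteq> 0" "y = abs_gclass b" by (rule gclass_cases)
  show ?thesis
    using a b by (simp add: abs_gclass_mult gnorm_abs gauss_ints_mult norm_mult power_mult_distrib)
qed

lemma gnorm_eq_1_iff: "gnorm x = 1 \<longleftrightarrow> x = 1"
proof
  assume g: "gnorm x = 1"
  obtain a where a: "a \<in> gauss_ints" "a \<noteq> 0" "x = abs_gclass a" by (rule gclass_cases)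
  have "a \<in> gauss_units" using g a by (intro gauss_cmod_eq_1) (simp_all add: gnorm_abs)
  then have "abs_gclass 1 = abs_gclass a"
    using a by (subst abs_gclass_eq_iff) (auto simp: gauss_ints_1)
  then show "x = 1" using a by (simp add: one_gclass_def)
next
  assume "x = 1"
  then show "gnorm x = 1" by (simp add: one_gclass_def gnorm_abs gauss_ints_1)
qed

lemma gclass_dvd_antisym:
  fixes x y :: gclass
  assumes "x dvd y" "y dvd x"
  shows "x = y"
proof -
  obtain k l where k: "y = x * k" and l: "x = y * l" using assms by (auto elim!: dvdE)
  have "gnorm x = gnorm x * (gnorm k * gnorm l)"
    using k l gnorm_mult by (metis mult.assoc)
  then have kl: "gnorm k * gnorm l = 1" using gnorm_ge_1[of x] by simp
  have "gnorm k \<le> gnorm k * gnorm l"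
    using gnorm_ge_1[of l] gnorm_ge_1[of k] by (simp add: mult_le_cancel_left1)
  then have "gnorm k = 1" using kl gnorm_ge_1[of k] by simp
  then show ?thesis using k by (simp add: gnorm_eq_1_iff)
qed

definition gclass_gcd :: "gclass \<Rightarrow> gclass \<Rightarrow> gclass" where
  "gclass_gcd x y = (THE d. d dvd x \<and> d dvd y \<and> (\<forall>c. c dvd x \<and> c dvd y \<longrightarrow> c dvd d))"

lemma gauss_division:
  assumes "x \<in> gauss_ints" "y \<in> gauss_ints" "y \<noteq> 0"
  obtains q where "q \<in> gauss_ints" "cmod (x - q * y) < cmod y"
proof -
  define w where "w = x / y"
  define q where "q = Complex (of_int (round (Re w))) (of_int (round (Im w)))"
  have "\<bar>Re (w - q)\<bar> \<le> 1/2" "\<bar>Im (w - q)\<bar> \<le> 1/2"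
    using of_int_round_abs_le[of "Re w"] of_int_round_abs_le[of "Im w"]
    by (simp_all add: q_def abs_minus_commute)
  then have "(Re (w - q))\<^sup>2 \<le> (1/2)\<^sup>2" "(Im (w - q))\<^sup>2 \<le> (1/2)\<^sup>2"
    using abs_le_square_iff[of "Re (w - q)" "1/2"] abs_le_square_iff[of "Im (w - q)" "1/2"]
    by simp_all
  then have "(cmod (w - q))\<^sup>2 < 1\<^sup>2"
    unfolding cmod_power2 by (simp add: power2_eq_square)
  then have "cmod (w - q) < 1" using power2_less_imp_less by fastforce
  moreover have "x - q * y = (w - q) * y" using assms(3) by (simp add: w_def algebra_simps)
  ultimately have "cmod (x - q * y) < cmod y" using assms(3) by (simp add: norm_mult)
  moreover have "q \<in> gauss_ints" by (auto simp: q_def gauss_ints_def)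
  ultimately show ?thesis using that by blast
qed

lemma gauss_bezout:
  assumes "y \<in> gauss_ints" "x \<in> gauss_ints" "x \<noteq> 0"
  shows "\<exists>d a b. d \<in> gauss_ints \<and> d \<noteq> 0 \<and> a \<in> gauss_ints \<and> b \<in> gauss_ints \<and> d = a * x + b * y
           \<and> (\<exists>c\<in>gauss_ints. x = d * c) \<and> (\<exists>c\<in>gauss_ints. y = d * c)"
  using assms
proof (induction "nat \<lfloor>(cmod y)\<^sup>2\<rfloor>" arbitrary: x y rule: less_induct)
  case less
  show ?case
  proof (cases "y = 0")
    case True
    then have "x = 1 * x + 0 * y" "\<exists>c\<in>gauss_ints. x = x * c" "\<exists>c\<in>gauss_ints. y = x * c"
      using gauss_ints_0 gauss_ints_1 by auto
    then show ?thesis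
      by (intro exI[of _ x] exI[of _ 1] exI[of _ 0] conjI less.prems(2,3) gauss_ints_0 gauss_ints_1)
  next
    case False
    obtain q where q: "q \<in> gauss_ints" "cmod (x - q * y) < cmod y"
      using gauss_division[OF less.prems(2,1) False] by blast
    define r where "r = x - q * y"
    have r: "r \<in> gauss_ints" using q less.prems by (simp add: r_def gauss_ints_diff gauss_ints_mult)
    have "(cmod r)\<^sup>2 \<in> \<int>" "(cmod y)\<^sup>2 \<in> \<int>"
      using r less.prems(1) by (simp_all add: gauss_ints_iff cmod_power2)
    then obtain m n where m: "(cmod r)\<^sup>2 = of_int m" and n: "(cmod y)\<^sup>2 = of_int n"
      by (elim Ints_cases)
    have "(cmod r)\<^sup>2 < (cmod y)\<^sup>2" using q(2) by (simp add: r_def power_strict_mono)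
    then have "m < n" unfolding m n by simp
    have "(cmod y)\<^sup>2 > 0" using False by simp
    then have "n > 0" unfolding n by simp
    with \<open>m < n\<close> have "nat \<lfloor>(cmod r)\<^sup>2\<rfloor> < nat \<lfloor>(cmod y)\<^sup>2\<rfloor>" unfolding m n by simp
    from less.hyps[OF this r less.prems(1) False]
    obtain d a b c c' where *: "d \<in> gauss_ints" "d \<noteq> 0" "a \<in> gauss_ints" "b \<in> gauss_ints"
        "d = a * y + b * r" "c \<in> gauss_ints" "y = d * c" "c' \<in> gauss_ints" "r = d * c'"
      by (elim exE conjE bexE)
    have 1: "d = b * x + (a - b * q) * y" using *(5) by (simp add: r_def algebra_simps)
    have 2: "a - b * q \<in> gauss_ints" using *(3,4) q by (simp add: gauss_ints_diff gauss_ints_mult)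
    have "x = r + q * y" by (simp add: r_def)
    then have 3: "x = d * (c' + q * c)" using *(7,9) by (simp add: algebra_simps)
    have "c' + q * c \<in> gauss_ints" using *(6,8) q by (simp add: gauss_ints_add gauss_ints_mult)
    with 3 have "\<exists>c\<in>gauss_ints. x = d * c" by (rule bexI)
    moreover have "\<exists>c\<in>gauss_ints. y = d * c" using *(7,6) by (rule bexI)
    ultimately show ?thesis
      by (intro exI[of _ d] exI[of _ b] exI[of _ "a - b * q"] conjI *(1,2,4) 1 2)
  qed
qed

lemma gclass_gcd_ex1: "\<exists>!d::gclass. d dvd x \<and> d dvd y \<and> (\<forall>c. c dvd x \<and> c dvd y \<longrightarrow> c dvd d)"
proof -
  obtain a where a: "a \<in> gauss_ints" "a \<noteq> 0" "x = abs_gclass a" by (rule gclass_cases)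
  obtain b where b: "b \<in> gauss_ints" "b \<noteq> 0" "y = abs_gclass b" by (rule gclass_cases)
  obtain d s t where d: "d \<in> gauss_ints" "d \<noteq> 0" "s \<in> gauss_ints" "t \<in> gauss_ints"
      "d = s * a + t * b" "\<exists>c\<in>gauss_ints. a = d * c" "\<exists>c\<in>gauss_ints. b = d * c"
    using gauss_bezout[OF b(1) a(1,2)] by blast
  have "c dvd abs_gclass d" if c: "c dvd x" "c dvd y" for c
  proof -
    obtain e where e: "e \<in> gauss_ints" "e \<noteq> 0" "c = abs_gclass e" by (rule gclass_cases)
    obtain k l where kl: "k \<in> gauss_ints" "a = e * k" "l \<in> gauss_ints" "b = e * l"
      using c a b e by (auto simp: gclass_dvd_iff)
    have "d = e * (s * k + t * l)" by (simp add: d(5) algebra_simps) (simp add: kl(2,4) algebra_simps)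
    moreover have "s * k + t * l \<in> gauss_ints" using kl(1,3) d(3,4) by (simp add: gauss_ints_add gauss_ints_mult)
    ultimately show ?thesis using e d(1,2) by (subst e(3), subst gclass_dvd_iff) auto
  qed
  moreover have "abs_gclass d dvd x" "abs_gclass d dvd y" using a b d(1,2,6,7) by (simp_all add: gclass_dvd_iff)
  ultimately show ?thesis by (blast intro: gclass_dvd_antisym)
qed

lemma gclass_gcd:
  "gclass_gcd x y dvd x" "gclass_gcd x y dvd y"
  "c dvd x \<Longrightarrow> c dvd y \<Longrightarrow> c dvd gclass_gcd x y"
  using theI'[OF gclass_gcd_ex1[of x y]] by (auto simp: gclass_gcd_def)

lemma gclass_UNIV:
  "(UNIV :: gclass set) = (\<lambda>(a, b). abs_gclass (Complex (of_int a) (of_int b))) ` (UNIV - {(0, 0)})"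
proof -
  have "x \<in> (\<lambda>(a, b). abs_gclass (Complex (of_int a) (of_int b))) ` (UNIV - {(0, 0)})" for x
  proof (rule gclass_cases[of x])
    fix z assume "z \<in> gauss_ints" "z \<noteq> 0" "x = abs_gclass z"
    moreover from this obtain a b where "z = Complex (of_int a) (of_int b)" by (auto simp: gauss_ints_def)
    ultimately show ?thesis by (intro image_eqI[of _ _ "(a, b)"]) (auto simp: complex_eq_iff)
  qed
  then show ?thesis by blast
qed

lemma gnorm_ints:
  assumes "(a, b) \<noteq> (0, 0)"
  shows "gnorm (abs_gclass (Complex (of_int a) (of_int b))) = of_int a ^ 2 + of_int b ^ 2"
  using assms by (subst gnorm_abs) (auto simp: gauss_ints_def complex_eq_iff cmod_power2)

lemma int_abs_summable:
  assumes "s > 1"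
  shows "Infinite_Set_Sum.abs_summable_on (\<lambda>a::int. (1 + \<bar>of_int a\<bar>) powr (-s) :: real) UNIV"
proof -
  have "summable (\<lambda>n. of_nat n powr (-s) :: real)" using assms by (simp add: summable_real_powr_iff)
  then have "summable (\<lambda>n. of_nat (Suc n) powr (-s) :: real)" by (subst summable_Suc_iff)
  then have n: "Infinite_Set_Sum.abs_summable_on (\<lambda>n. (1 + real n) powr (-s)) UNIV"
    by (simp add: abs_summable_on_nat_iff' add.commute)
  have "Infinite_Set_Sum.abs_summable_on (\<lambda>a::int. (1 + \<bar>of_int a\<bar>) powr (-s) :: real) (range int)"
    using n by (intro abs_summable_on_reindex) simp
  moreover have "Infinite_Set_Sum.abs_summable_on (\<lambda>a::int. (1 + \<bar>of_int a\<bar>) powr (-s) :: real) (range (\<lambda>n. - int n))"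
    using n by (intro abs_summable_on_reindex) simp
  moreover have "(UNIV :: int set) = range int \<union> range (\<lambda>n. - int n)"
    by (auto intro: int_cases2)
  ultimately show ?thesis using abs_summable_on_union by metis
qed

lemma gnorm_abs_summable:
  assumes "s > 1"
  shows "Infinite_Set_Sum.abs_summable_on (\<lambda>z. gnorm z powr (-s)) UNIV"
  unfolding gclass_UNIV
proof (rule abs_summable_on_reindex, rule abs_summable_on_comparison_test')
  let ?f = "\<lambda>a::int. (1 + \<bar>of_int a\<bar>) powr (-s) :: real"
  have "Infinite_Set_Sum.abs_summable_on (\<lambda>(a, b). ?f a * ?f b) (UNIV \<times> UNIV)"
    using int_abs_summable[OF assms] by (intro abs_summable_on_product) auto
  then show "Infinite_Set_Sum.abs_summable_on (\<lambda>p. 9 powr s * (case p of (a, b) \<Rightarrow> ?f a * ?f b)) (UNIV - {(0, 0)})"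
    by (intro abs_summable_on_cmult_right) (auto intro: abs_summable_on_subset)
next
  let ?f = "\<lambda>a::int. (1 + \<bar>of_int a\<bar>) powr (-s) :: real"
  fix p :: "int \<times> int" assume p: "p \<in> UNIV - {(0, 0)}"
  obtain a b where ab: "p = (a, b)" by (cases p)
  define A B where "A = \<bar>real_of_int a\<bar>" and "B = \<bar>real_of_int b\<bar>"
  have "\<bar>a\<bar> + \<bar>b\<bar> \<ge> 1" using p ab by auto
  then have 1: "A + B \<ge> 1" unfolding A_def B_def by linarith
  have 0: "A \<ge> 0" "B \<ge> 0" by (simp_all add: A_def B_def)
  have "(1 + A) * (1 + B) \<le> (A + B + (A + B)) * (A + B + (A + B))"
    using 0 1 by (intro mult_mono) auto
  also have "\<dots> = 4 * (A\<^sup>2 + B\<^sup>2) + 8 * (A * B)" by (simp add: power2_eq_square algebra_simps)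
  also have "\<dots> \<le> 8 * (A\<^sup>2 + B\<^sup>2)"
    using zero_le_power2[of "A - B"] by (simp add: power2_eq_square algebra_simps)
  also have "\<dots> \<le> 9 * (A\<^sup>2 + B\<^sup>2)" by simp
  finally have le: "(1 + A) * (1 + B) \<le> 9 * (A\<^sup>2 + B\<^sup>2)" .
  have "0 < (1 + A) * (1 + B)" using 0 by simp
  also note le
  finally have pos: "A\<^sup>2 + B\<^sup>2 > 0" by simp
  have "(9 * (A\<^sup>2 + B\<^sup>2)) powr (-s) \<le> ((1 + A) * (1 + B)) powr (-s)"
    using le 0 assms by (intro powr_mono2') auto
  then have "9 powr s * (9 * (A\<^sup>2 + B\<^sup>2)) powr (-s) \<le> 9 powr s * ((1 + A) * (1 + B)) powr (-s)"
    by (intro mult_left_mono) auto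
  moreover have "(9 * (A\<^sup>2 + B\<^sup>2)) powr (-s) = 9 powr (-s) * (A\<^sup>2 + B\<^sup>2) powr (-s)"
    by (rule powr_mult)
  moreover have "((1 + A) * (1 + B)) powr (-s) = (1 + A) powr (-s) * (1 + B) powr (-s)"
    by (rule powr_mult)
  moreover have "9 powr s * (9 powr (-s) * (A\<^sup>2 + B\<^sup>2) powr (-s)) = (A\<^sup>2 + B\<^sup>2) powr (-s)"
    by (simp add: powr_minus)
  ultimately have "(A\<^sup>2 + B\<^sup>2) powr (-s) \<le> 9 powr s * ((1 + A) powr (-s) * (1 + B) powr (-s))"
    by (simp only:)
  moreover have "A\<^sup>2 + B\<^sup>2 = gnorm (abs_gclass (Complex (of_int a) (of_int b)))"
    using p ab by (subst gnorm_ints) (auto simp: A_def B_def)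
  ultimately show "norm (gnorm (case p of (a, b) \<Rightarrow> abs_gclass (Complex (of_int a) (of_int b))) powr (-s))
      \<le> 9 powr s * (case p of (a, b) \<Rightarrow> ?f a * ?f b)"
    by (simp add: ab A_def B_def)
qed

lemma gnorm_summable_on:
  assumes "s > 1"
  shows "(\<lambda>z. gnorm z powr (-s)) summable_on UNIV"
  using gnorm_abs_summable[OF assms] abs_summable_equivalent abs_summable_summable by blast

lemma gnorm_infsum_pos:
  assumes "s > 1"
  shows "(\<Sum>\<^sub>\<infinity>z. gnorm z powr (-s)) > 0"
proof -
  have "(\<Sum>\<^sub>\<infinity>z\<in>{1}. gnorm z powr (-s)) \<le> (\<Sum>\<^sub>\<infinity>z. gnorm z powr (-s))"
    using gnorm_summable_on[OF assms] by (intro infsum_mono_neutral) auto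
  moreover have "gnorm 1 = 1" by (simp add: gnorm_eq_1_iff)
  ultimately show ?thesis by simp
qed

definition gclass_zeta :: "real \<Rightarrow> gclass pmf" where
  "gclass_zeta s =
     embed_pmf (\<lambda>x. inverse (\<Sum>\<^sub>\<infinity>z. gnorm z powr (-s)) * gnorm x powr (-s))"

lemma pmf_gclass_zeta:
  assumes "s > 1"
  shows "pmf (gclass_zeta s) x = inverse (\<Sum>\<^sub>\<infinity>z. gnorm z powr (-s)) * gnorm x powr (-s)"
  unfolding gclass_zeta_def
proof (rule pmf_embed_pmf)
  let ?S = "\<Sum>\<^sub>\<infinity>z. gnorm z powr (-s)"
  have S: "?S > 0" by (rule gnorm_infsum_pos[OF assms])
  show "0 \<le> inverse ?S * gnorm x powr (-s)" for x using S by simp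
  have "(\<integral>\<^sup>+x. ennreal (inverse ?S * gnorm x powr (-s)) \<partial>count_space UNIV)
      = ennreal (infsetsum (\<lambda>x. inverse ?S * gnorm x powr (-s)) UNIV)"
    using S gnorm_abs_summable[OF assms]
    by (intro nn_integral_conv_infsetsum abs_summable_on_cmult_right) auto
  also have "infsetsum (\<lambda>x. inverse ?S * gnorm x powr (-s)) UNIV
      = inverse ?S * infsetsum (\<lambda>x. gnorm x powr (-s)) UNIV"
    using gnorm_abs_summable[OF assms] by (intro infsetsum_cmult_right) auto
  also have "infsetsum (\<lambda>x. gnorm x powr (-s)) UNIV = ?S"
    using gnorm_abs_summable[OF assms] by (intro infsetsum_infsum)
  finally show "(\<integral>\<^sup>+x. ennreal (inverse ?S * gnorm x powr (-s)) \<partial>count_space UNIV) = 1"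
    using S by simp
qed

lemma finite_gnorm_le: "finite {z. gnorm z \<le> r}"
proof -
  define m where "m = \<lceil>r\<rceil>"
  have "{z. gnorm z \<le> r}
      \<subseteq> (\<lambda>(a, b). abs_gclass (Complex (of_int a) (of_int b))) ` ({-m..m} \<times> {-m..m})"
  proof
    fix z assume z: "z \<in> {z. gnorm z \<le> r}"
    have "z \<in> (\<lambda>(a, b). abs_gclass (Complex (of_int a) (of_int b))) ` (UNIV - {(0, 0)})"
      using gclass_UNIV by blast
    then obtain a b where ab: "(a, b) \<noteq> (0, 0)" "z = abs_gclass (Complex (of_int a) (of_int b))"
      by auto
    have "real_of_int (a\<^sup>2 + b\<^sup>2) \<le> r" using z ab gnorm_ints[OF ab(1)] by simp
    then have "a\<^sup>2 + b\<^sup>2 \<le> m" unfolding m_def by linarith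
    moreover have "\<bar>c\<bar> \<le> c\<^sup>2" for c :: int
      using self_le_power[of "\<bar>c\<bar>" 2] by (cases "c = 0") auto
    from this[of a] this[of b] have "\<bar>a\<bar> + \<bar>b\<bar> \<le> a\<^sup>2 + b\<^sup>2" by simp
    ultimately have "a \<in> {-m..m}" "b \<in> {-m..m}" by auto
    then show "z \<in> (\<lambda>(a, b). abs_gclass (Complex (of_int a) (of_int b))) ` ({-m..m} \<times> {-m..m})"
      using ab by auto
  qed
  then show ?thesis by (rule finite_subset) simp
qed

lemma gnorm_le_nonempty: "r \<ge> 1 \<Longrightarrow> {z. gnorm z \<le> r} \<noteq> {}"
  using gnorm_eq_1_iff[of 1] by (auto intro!: exI[of _ 1])

definition zeta_real :: "real \<Rightarrow> real" where
  "zeta_real s = (\<Sum>k. real (Suc k) powr (-s))"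

definition beta_real :: "real \<Rightarrow> real" where
  "beta_real s = (\<Sum>n. (-1) ^ n / real (2 * n + 1) powr s)"

text \<open>The target is a discrete probability, so convergence of the point masses is required.\<close>

definition converges_in_law ::
    "(nat \<Rightarrow> 'm measure) \<Rightarrow> (nat \<Rightarrow> 'm \<Rightarrow> 'a) \<Rightarrow> 'a pmf \<Rightarrow> bool" where
  "converges_in_law M Z P \<longleftrightarrow>
     (\<forall>x. (\<lambda>n. \<P>(\<omega> in M n. Z n \<omega> = x)) \<longlonglongrightarrow> pmf P x)"

end

theory Submission
  imports Defs "HOL-Number_Theory.Euler_Criterion"
begin

text \<open>
  Write \<open>A(r)\<close> for the number of classes of norm at most \<open>r\<close> and \<open>D(r)\<close> for the number of coprime
  pairs of such classes. Multiplication by \<open>g\<close> maps the coprime pairs with norms at most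
  \<open>r / N(g)\<close> bijectively onto the pairs with norms at most \<open>r\<close> and gcd \<open>g\<close>
  (\<open>card_gcd_pairs\<close>), so the probability that the gcd is \<open>g\<close> is \<open>D(n\<^sup>2 / N(g)) / A(n\<^sup>2)\<^sup>2\<close>. Everything
  follows from the growth of \<open>A\<close> and \<open>D\<close> and from the value of \<open>G = \<Sum> N(z)^(-2)\<close>.

  \<^item> \<open>A(r) / r\<close> tends to the area \<open>c\<close> of a quarter of the unit disc (\<open>norm_le_count_asymp\<close>): each class has
    one representative \<open>a + ib\<close> with \<open>a \<ge> 0\<close>, \<open>b > 0\<close>, so \<open>A(r)\<close> counts lattice points in a
    quarter disc, and a monotone sum is compared with an integral.

  \<^item> \<open>D(r) / r\<^sup>2\<close> tends to \<open>c\<^sup>2 / G\<close> (\<open>coprime_count_asymp\<close>). Instead of Moebius inversion, the argument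
    is a contraction. Sorting all pairs by their gcd gives \<open>A(r)\<^sup>2 = \<Sum>\<^sub>g D(r / N(g))\<close>; hence the error
    \<open>e(r) = D(r) / r\<^sup>2 - c\<^sup>2 / G\<close> satisfies \<open>e(r) = o(1) - \<Sum> N(g)^(-2) e(r / N(g))\<close>, the sum
    being over \<open>g \<noteq> 1\<close>. The weights add up to \<open>G - 1\<close>, so the upper limit \<open>l\<close> of \<open>\<bar>e\<bar>\<close> satisfies
    \<open>l \<le> (G - 1) l\<close>. This forces \<open>l = 0\<close> because \<open>G < 2\<close>.

  \<^item> \<open>G = \<zeta>(2) \<beta>(2)\<close> (\<open>gnorm_zeta_eq\<close>), which is also where \<open>G < 2\<close> comes from. Grouping the sum by
    norm, this is the identity between the number of classes of norm \<open>n\<close> and the sum over the divisors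
    \<open>d\<close> of \<open>n\<close> of the character modulo 4 (\<open>norm_eq_count_eq_divisor_sum\<close>). Both sides
    satisfy \<open>f(pn) = (1 + \<chi>(p)) f(n) - \<chi>(p) f(n/p)\<close> for every prime \<open>p\<close>, with \<open>f(n/p) = 0\<close> when \<open>p\<close>
    does not divide \<open>n\<close>: for the divisor sum by splitting the divisors of \<open>pn\<close> into divisors of \<open>n\<close>
    and multiples of \<open>p\<close>, for the count by the splitting of \<open>p\<close> in the Gaussian integers.
\<close>

section \<open>Gaussian integers up to associates in coordinates\<close>

text \<open>
  The class of \<open>a + ib\<close>. It is meaningful only for \<open>(a, b) \<noteq> (0, 0)\<close>, since \<open>0\<close> has no class.
\<close>
definition gclass_of :: "int \<Rightarrow> int \<Rightarrow> gclass" where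
  "gclass_of a b = abs_gclass (Complex (of_int a) (of_int b))"

lemma Complex_in_gauss_ints [simp]: "Complex (of_int a) (of_int b) \<in> gauss_ints"
  by (auto simp: gauss_ints_def)

lemma Complex_of_int_eq_0_iff [simp]: "Complex (of_int a) (of_int b) = 0 \<longleftrightarrow> a = 0 \<and> b = 0"
  by (auto simp: complex_eq_iff)

lemma gclass_of_cases:
  obtains a b where "(a, b) \<noteq> (0, 0)" "x = gclass_of a b"
proof (rule gclass_cases[of x])
  fix z assume "z \<in> gauss_ints" "z \<noteq> 0" "x = abs_gclass z"
  then show ?thesis using that by (auto simp: gauss_ints_def gclass_of_def)
qed

lemma gnorm_gclass_of:
  "(a, b) \<noteq> (0, 0) \<Longrightarrow> gnorm (gclass_of a b) = of_int (a\<^sup>2 + b\<^sup>2)"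
  unfolding gclass_of_def by (subst gnorm_ints) auto

lemma bex_gauss_ints: "(\<exists>z\<in>gauss_ints. P z) \<longleftrightarrow> (\<exists>a b. P (Complex (of_int a) (of_int b)))"
  by (auto simp: gauss_ints_def)

lemma gclass_of_mult:
  assumes "(a, b) \<noteq> (0, 0)" "(c, d) \<noteq> (0, 0)"
  shows "gclass_of a b * gclass_of c d = gclass_of (a * c - b * d) (a * d + b * c)"
  using assms unfolding gclass_of_def
  by (subst abs_gclass_mult) (auto simp: complex_mult algebra_simps complex_eq_iff)

lemma gclass_of_dvd_iff:
  assumes "(u, v) \<noteq> (0, 0)" "(a, b) \<noteq> (0, 0)"
  shows "gclass_of u v dvd gclass_of a b \<longleftrightarrow>
           (\<exists>c d. a = u * c - v * d \<and> b = u * d + v * c)"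
proof -
  have eq: "Complex (of_int a) (of_int b) = Complex (of_int u) (of_int v) * Complex (of_int c) (of_int d)
        \<longleftrightarrow> a = u * c - v * d \<and> b = u * d + v * c" for c d
    by (simp add: complex_mult complex_eq_iff flip: of_int_mult of_int_diff of_int_add)
  show ?thesis
    unfolding gclass_of_def using assms
    by (subst gclass_dvd_iff) (simp_all only: bex_gauss_ints eq Complex_in_gauss_ints Complex_of_int_eq_0_iff prod.inject, simp_all)
qed

lemma gclass_dvd_mult_cancel:
  fixes x y z :: gclass
  assumes "x * y dvd x * z"
  shows "y dvd z"
proof -
  obtain a where a: "a \<in> gauss_ints" "a \<noteq> 0" "x = abs_gclass a" by (rule gclass_cases)
  obtain b where b: "b \<in> gauss_ints" "b \<noteq> 0" "y = abs_gclass b" by (rule gclass_cases)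
  obtain c where c: "c \<in> gauss_ints" "c \<noteq> 0" "z = abs_gclass c" by (rule gclass_cases)
  show ?thesis
    using assms a b c by (auto simp: abs_gclass_mult gclass_dvd_iff gauss_ints_mult mult.assoc)
qed

lemma gclass_mult_left_cancel:
  fixes x y z :: gclass
  shows "x * y = x * z \<longleftrightarrow> y = z"
  using gclass_dvd_mult_cancel[of x y z] gclass_dvd_mult_cancel[of x z y]
  by (auto intro: gclass_dvd_antisym)

lemma inj_gclass_mult: "inj_on ((*) (x :: gclass)) A"
  by (simp add: inj_on_def gclass_mult_left_cancel)

lemma gclass_gcd_mult: "gclass_gcd (g * x) (g * y) = g * gclass_gcd x y"
proof (rule gclass_dvd_antisym)
  have "g dvd gclass_gcd (g * x) (g * y)" by (intro gclass_gcd(3)) simp_all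
  then obtain k where k: "gclass_gcd (g * x) (g * y) = g * k" by (elim dvdE)
  have "g * k dvd g * x" "g * k dvd g * y" by (metis k gclass_gcd(1), metis k gclass_gcd(2))
  then have "k dvd gclass_gcd x y" by (intro gclass_gcd(3)) (auto dest: gclass_dvd_mult_cancel)
  then show "gclass_gcd (g * x) (g * y) dvd g * gclass_gcd x y" by (simp add: k mult_dvd_mono)
qed (intro gclass_gcd mult_dvd_mono dvd_refl)

section \<open>Lattice points in a quarter disc\<close>

definition norm_le_count :: "real \<Rightarrow> nat" where
  "norm_le_count r = card {z. gnorm z \<le> r}"

lemma gclass_of_rotate:
  assumes "(a, b) \<noteq> (0, 0)"
  shows "gclass_of (- b) a = gclass_of a b"
proof (rule gclass_dvd_antisym)
  show "gclass_of (- b) a dvd gclass_of a b"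
    by (rule gclass_of_dvd_iff[THEN iffD2, OF _ _ exI[of _ 0], OF _ _ exI[of _ "- 1"]])
       (use assms in auto)
  show "gclass_of a b dvd gclass_of (- b) a"
    by (rule gclass_of_dvd_iff[THEN iffD2, OF _ _ exI[of _ 0], OF _ _ exI[of _ 1]])
       (use assms in auto)
qed

lemma gclass_of_eqD:
  assumes "(a, b) \<noteq> (0, 0)" "(c, d) \<noteq> (0, 0)" "gclass_of a b = gclass_of c d"
  shows "(c, d) \<in> {(a, b), (- b, a), (- a, - b), (b, - a)}"
proof -
  obtain u where "u \<in> gauss_units"
      "Complex (of_int c) (of_int d) = u * Complex (of_int a) (of_int b)"
    using assms by (auto simp: gclass_of_def abs_gclass_eq_iff)
  then show ?thesis
    by (auto simp: gauss_units_def complex_eq_iff simp flip: of_int_minus)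
qed

text \<open>
  The four associates of a nonzero Gaussian integer are its rotations by quarter turns, and exactly one
  of them lies in the quadrant \<open>a \<ge> 0\<close>, \<open>b > 0\<close>. The second coordinate is shifted so that the
  quadrant becomes all pairs of natural numbers.
\<close>
lemma bij_betw_quadrant: "bij_betw (\<lambda>(a, b). gclass_of (int a) (int (Suc b))) UNIV UNIV"
  unfolding bij_betw_def
proof (intro conjI subset_antisym subset_UNIV subsetI)
  show "inj (\<lambda>(a, b). gclass_of (int a) (int (Suc b)))"
    by (auto simp: inj_def dest!: gclass_of_eqD[rotated 2])
next
  fix x
  obtain a b where ab: "(a, b) \<noteq> (0, 0)" "x = gclass_of a b" by (rule gclass_of_cases)
  have "gclass_of (- b) a = x" "gclass_of (- a) (- b) = x" "gclass_of b (- a) = x"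
    using gclass_of_rotate[of a b] gclass_of_rotate[of "- b" a] gclass_of_rotate[of "- a" "- b"] ab
    by auto
  moreover have "a \<ge> 0 \<and> b > 0 \<or> - b \<ge> 0 \<and> a > 0 \<or> - a \<ge> 0 \<and> - b > 0 \<or> b \<ge> 0 \<and> - a > 0"
    using ab(1) by auto
  ultimately obtain c d where cd: "c \<ge> 0" "d > 0" "x = gclass_of c d"
    using ab(2) by metis
  then have "c = int (nat c)" "d = int (Suc (nat (d - 1)))" by auto
  then show "x \<in> range (\<lambda>(a, b). gclass_of (int a) (int (Suc b)))"
    using cd(3) by (intro image_eqI[of _ _ "(nat c, nat (d - 1))"]) auto
qed

text \<open>
  The maximum with \<open>0\<close> extends the quarter circle by \<open>0\<close> beyond its radius, keeping it continuous and
  decreasing on the whole half-line, as the comparison of sums with integrals requires.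
\<close>
definition quarter_circle :: "real \<Rightarrow> real \<Rightarrow> real" where
  "quarter_circle t x = sqrt (max 0 (t\<^sup>2 - x\<^sup>2))"

lemma card_Suc_square_le: "card {b. (real (Suc b))\<^sup>2 \<le> x} = nat \<lfloor>sqrt (max 0 x)\<rfloor>"
proof -
  have "(real (Suc b))\<^sup>2 \<le> x \<longleftrightarrow> b < nat \<lfloor>sqrt (max 0 x)\<rfloor>" for b
  proof -
    have "b < nat \<lfloor>sqrt (max 0 x)\<rfloor> \<longleftrightarrow> real (Suc b) \<le> sqrt (max 0 x)" by linarith
    also have "\<dots> \<longleftrightarrow> (real (Suc b))\<^sup>2 \<le> max 0 x"
      using real_sqrt_le_iff[of "(real (Suc b))\<^sup>2" "max 0 x"] by simp
    also have "\<dots> \<longleftrightarrow> (real (Suc b))\<^sup>2 \<le> x"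
      using zero_less_power[of "real (Suc b)" 2] by linarith
    finally show ?thesis by blast
  qed
  then have "{b. (real (Suc b))\<^sup>2 \<le> x} = {..<nat \<lfloor>sqrt (max 0 x)\<rfloor>}" by auto
  then show ?thesis by simp
qed

text \<open>
  Counting the lattice points of the quarter disc column by column.
\<close>
lemma norm_le_count_eq_sum:
  assumes t: "t \<ge> 0" "t \<le> real n"
  shows "norm_le_count (t\<^sup>2) = (\<Sum>a\<le>n. nat \<lfloor>quarter_circle t (real a)\<rfloor>)"
proof -
  have g: "gnorm (gclass_of (int a) (int (Suc b))) = (real a)\<^sup>2 + (real (Suc b))\<^sup>2" for a b
    by (subst gnorm_gclass_of) auto
  let ?B = "\<lambda>a. {b. (real (Suc b))\<^sup>2 \<le> t\<^sup>2 - (real a)\<^sup>2}"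
  have fin: "finite (?B a)" for a
  proof (rule finite_subset)
    show "?B a \<subseteq> {..n}"
    proof
      fix b assume "b \<in> ?B a"
      then have "(real (Suc b))\<^sup>2 \<le> t\<^sup>2 - (real a)\<^sup>2" by blast
      also have "\<dots> \<le> t\<^sup>2" by simp
      finally have "real (Suc b) \<le> t" using t(1) by (rule power2_le_imp_le)
      then show "b \<in> {..n}" using t(2) by simp
    qed
  qed simp
  have "bij_betw (\<lambda>(a, b). gclass_of (int a) (int (Suc b)))
      {(a, b). (real a)\<^sup>2 + (real (Suc b))\<^sup>2 \<le> t\<^sup>2} {z. gnorm z \<le> t\<^sup>2}"
  proof (rule bij_betw_subset[OF bij_betw_quadrant])
    have "\<exists>a b. z = gclass_of (int a) (int (Suc b))" for z
      using bij_betw_quadrant unfolding bij_betw_def by fastforce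
    then show "(\<lambda>(a, b). gclass_of (int a) (int (Suc b))) `
        {(a, b). (real a)\<^sup>2 + (real (Suc b))\<^sup>2 \<le> t\<^sup>2} = {z. gnorm z \<le> t\<^sup>2}"
      by (auto simp: g simp del: of_nat_Suc) (metis (mono_tags, lifting) case_prod_conv g image_eqI mem_Collect_eq)
  qed simp
  then have "norm_le_count (t\<^sup>2) = card {(a, b). (real a)\<^sup>2 + (real (Suc b))\<^sup>2 \<le> t\<^sup>2}"
    unfolding norm_le_count_def by (simp add: bij_betw_same_card)
  also have "{(a, b). (real a)\<^sup>2 + (real (Suc b))\<^sup>2 \<le> t\<^sup>2} = (SIGMA a:{..n}. ?B a)"
  proof -
    have "a \<le> n" if "(real a)\<^sup>2 + (real (Suc b))\<^sup>2 \<le> t\<^sup>2" for a b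
    proof -
      have "(real a)\<^sup>2 \<le> t\<^sup>2" using that zero_le_power2[of "real (Suc b)"] by linarith
      then have "real a \<le> t" using t(1) by (rule power2_le_imp_le)
      then show ?thesis using t(2) by simp
    qed
    then show ?thesis by (auto simp: algebra_simps)
  qed
  also have "card \<dots> = (\<Sum>a\<le>n. card (?B a))" using fin by (intro card_SigmaI) auto
  finally show ?thesis by (simp only: card_Suc_square_le quarter_circle_def)
qed

definition quarter_disc_area :: real where
  "quarter_disc_area = integral {0..1} (quarter_circle 1)"

lemma quarter_circle_continuous: "continuous_on A (quarter_circle t)"
  unfolding quarter_circle_def by (intro continuous_intros)

lemma quarter_circle_integrable: "quarter_circle t integrable_on {a..b}"
  by (rule integrable_continuous_real[OF quarter_circle_continuous])

text \<open>
  Substituting \<open>x = t y\<close> reduces to the unit circle, since \<open>quarter_circle t (t y) = t * quarter_circle 1 y\<close>.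
\<close>
lemma quarter_circle_integral:
  assumes t: "t > 0" "t \<le> n"
  shows "integral {0..n} (quarter_circle t) = quarter_disc_area * t\<^sup>2"
proof -
  have eq: "quarter_circle 1 (x / t) = quarter_circle t x / t" for x
  proof -
    have "max 0 (1\<^sup>2 - (x / t)\<^sup>2) = max 0 (t\<^sup>2 - x\<^sup>2) / t\<^sup>2"
      using t(1) by (auto simp: max_def field_simps power2_eq_square)
    then show ?thesis using t(1) by (simp only: quarter_circle_def real_sqrt_divide) simp
  qed
  have "(quarter_circle 1 has_integral quarter_disc_area) (cbox 0 1)"
    unfolding quarter_disc_area_def cbox_interval
    by (rule integrable_integral[OF quarter_circle_integrable])
  from has_integral_affinity'[OF this, of "1 / t" 0]
  have "((\<lambda>x. quarter_circle t x / t) has_integral quarter_disc_area * t) {0..t}"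
    using t(1) by (simp add: eq mult.commute)
  from has_integral_mult_right[OF this, of t]
  have "(quarter_circle t has_integral quarter_disc_area * t\<^sup>2) {0..t}"
    using t(1) by (simp add: power2_eq_square mult_ac)
  then have 1: "integral {0..t} (quarter_circle t) = quarter_disc_area * t\<^sup>2" by (rule integral_unique)
  have "integral {t..n} (quarter_circle t) = integral {t..n} (\<lambda>_. 0)"
  proof (rule integral_cong)
    fix x assume "x \<in> {t..n}"
    then have "t\<^sup>2 \<le> x\<^sup>2" using t(1) by (intro power_mono) auto
    then show "quarter_circle t x = 0" by (simp add: quarter_circle_def max_def)
  qed
  then have "integral {t..n} (quarter_circle t) = 0" by simp
  then show ?thesis
    using Henstock_Kurzweil_Integration.integral_combine[OF _ t(2) quarter_circle_integrable, of 0 t] t(1) 1 by simp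
qed

text \<open>
  On \<open>[0, 1]\<close> the circle lies above the chord: \<open>(1 - x)\<^sup>2 \<le> 1 - x\<^sup>2\<close>.
\<close>
lemma quarter_disc_area_pos: "quarter_disc_area > 0"
proof -
  have "((\<lambda>x::real. 1 - x) has_integral (1 - 1 / 2)) {0..1}"
    using has_integral_diff[OF has_integral_const_real[of "1::real" 0 1] ident_has_integral[of 0 1]] by simp
  then have "1 / 2 \<le> quarter_disc_area"
    unfolding quarter_disc_area_def
  proof (rule has_integral_le[OF _ integrable_integral[OF quarter_circle_integrable], THEN order_trans[rotated]])
    fix x :: real assume x: "x \<in> {0..1}"
    then have "x * x \<le> 1 * x" by (intro mult_right_mono) auto
    then have "(1 - x)\<^sup>2 \<le> 1 - x\<^sup>2" using x by (simp add: power2_eq_square algebra_simps)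
    then have "sqrt ((1 - x)\<^sup>2) \<le> sqrt (max 0 (1\<^sup>2 - x\<^sup>2))" by (intro real_sqrt_le_mono) auto
    then show "1 - x \<le> quarter_circle 1 x" using x by (simp add: quarter_circle_def)
  qed simp
  then show ?thesis by simp
qed

text \<open>
  The sum of the heights of the columns differs from the area by at most the first height \<open>t\<close>, because
  the heights decrease; rounding each of the at most \<open>t + 2\<close> heights down loses less than \<open>1\<close> each.
\<close>
lemma norm_le_count_approx:
  assumes t: "t > 0"
  shows "\<bar>real (norm_le_count (t\<^sup>2)) - quarter_disc_area * t\<^sup>2\<bar> \<le> 2 * t + 2"
proof -
  define n where "n = nat \<lceil>t\<rceil>"
  have n: "t \<le> real n" "real n \<le> t + 1" using t unfolding n_def by linarith+
  interpret antimono_fun_sum_integral_diff "quarter_circle t"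
  proof
    show "quarter_circle t y \<le> quarter_circle t x" if "0 \<le> x" "x \<le> y" for x y
    proof -
      have "x\<^sup>2 \<le> y\<^sup>2" using that by (intro power_mono)
      then show ?thesis unfolding quarter_circle_def by (intro real_sqrt_le_mono) linarith
    qed
    show "0 \<le> quarter_circle t x" for x by (simp add: quarter_circle_def)
  qed (rule quarter_circle_continuous)
  let ?S = "\<Sum>a\<le>n. quarter_circle t (real a)"
  have "sum_integral_diff_series n \<le> sum_integral_diff_series 0"
    by (rule sum_integral_diff_series_antimono) simp
  also have "\<dots> = t" using t by (simp add: sum_integral_diff_series_def quarter_circle_def)
  finally have "?S - quarter_disc_area * t\<^sup>2 \<le> t"
    by (simp add: sum_integral_diff_series_def quarter_circle_integral[OF t n(1)])
  moreover have "?S - quarter_disc_area * t\<^sup>2 \<ge> 0"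
    using sum_integral_diff_series_nonneg[of n]
    by (simp add: sum_integral_diff_series_def quarter_circle_integral[OF t n(1)])
  moreover have G: "real (norm_le_count (t\<^sup>2)) = (\<Sum>a\<le>n. real (nat \<lfloor>quarter_circle t (real a)\<rfloor>))"
    using t n by (simp add: norm_le_count_eq_sum)
  have fl: "real (nat \<lfloor>quarter_circle t x\<rfloor>) \<le> quarter_circle t x"
    "quarter_circle t x \<le> real (nat \<lfloor>quarter_circle t x\<rfloor>) + 1" for x
    by (simp_all add: quarter_circle_def)
  have "real (norm_le_count (t\<^sup>2)) \<le> ?S" unfolding G by (intro sum_mono fl)
  moreover have "?S \<le> (\<Sum>a\<le>n. real (nat \<lfloor>quarter_circle t (real a)\<rfloor>) + 1)" by (intro sum_mono fl)
  then have "?S \<le> real (norm_le_count (t\<^sup>2)) + real (n + 1)" unfolding G by (simp add: sum.distrib)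
  ultimately show ?thesis using n by (simp add: abs_le_iff)
qed

lemma norm_le_count_0: "r < 1 \<Longrightarrow> norm_le_count r = 0"
proof -
  assume "r < 1"
  then have "{z. gnorm z \<le> r} = {}" using gnorm_ge_1 by (auto simp: not_le intro: less_le_trans)
  then show ?thesis by (simp add: norm_le_count_def)
qed

lemma norm_le_count_asymp: "((\<lambda>r. real (norm_le_count r) / r) \<longlongrightarrow> quarter_disc_area) at_top"
proof -
  have "((\<lambda>r. real (norm_le_count r) / r - quarter_disc_area) \<longlongrightarrow> 0) at_top"
  proof (rule Lim_null_comparison)
    show "\<forall>\<^sub>F r in at_top. norm (real (norm_le_count r) / r - quarter_disc_area) \<le> (2 * sqrt r + 2) / r"
      using eventually_gt_at_top[of 0]
    proof eventually_elim
      case (elim r)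
      have "\<bar>real (norm_le_count r) - quarter_disc_area * r\<bar> \<le> 2 * sqrt r + 2"
        using norm_le_count_approx[of "sqrt r"] elim by simp
      moreover have "real (norm_le_count r) / r - quarter_disc_area = (real (norm_le_count r) - quarter_disc_area * r) / r"
        using elim by (simp add: field_simps)
      ultimately show ?case using elim by (simp add: divide_right_mono)
    qed
    show "((\<lambda>r::real. (2 * sqrt r + 2) / r) \<longlongrightarrow> 0) at_top" by real_asymp
  qed
  then show ?thesis by (simp add: LIM_zero_iff)
qed

lemma norm_le_count_le:
  obtains K where "K > 0" "\<And>r. r > 0 \<Longrightarrow> real (norm_le_count r) \<le> K * r"
proof
  show "quarter_disc_area + 4 > 0" using quarter_disc_area_pos by simp
  fix r :: real assume r: "r > 0"
  show "real (norm_le_count r) \<le> (quarter_disc_area + 4) * r"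
  proof (cases "r < 1")
    case True
    then show ?thesis using r quarter_disc_area_pos by (simp add: norm_le_count_0)
  next
    case False
    have "real (norm_le_count r) \<le> quarter_disc_area * r + 2 * sqrt r + 2"
      using norm_le_count_approx[of "sqrt r"] r by simp
    moreover have "sqrt r \<le> r" using False real_le_lsqrt[of r r] by (simp add: self_le_power)
    ultimately show ?thesis using False by (simp add: algebra_simps)
  qed
qed

section \<open>The number of classes of a given norm\<close>

text \<open>
  The nontrivial Dirichlet character modulo 4, the coefficients of the series of \<open>\<beta>\<close>.
\<close>
definition chi4 :: "nat \<Rightarrow> int" where
  "chi4 n = (if even n then 0 else if n mod 4 = 1 then 1 else -1)"

lemma chi4_mod: "chi4 (n mod 4) = chi4 n"
proof -
  have "even (n mod 4) \<longleftrightarrow> even n" by presburger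
  then show ?thesis by (simp add: chi4_def)
qed

lemma chi4_mult: "chi4 (m * n) = chi4 m * chi4 n"
proof -
  have "m mod 4 < 4" "n mod 4 < 4" by simp_all
  then have "m mod 4 \<in> {0,1,2,3}" "n mod 4 \<in> {0,1,2,3}" by auto
  then have "chi4 ((m mod 4) * (n mod 4)) = chi4 (m mod 4) * chi4 (n mod 4)"
    by (elim insertE emptyE) (simp_all add: chi4_def)
  then show ?thesis by (metis chi4_mod mod_mult_eq)
qed

definition divisor_chi4_sum :: "nat \<Rightarrow> int" where
  "divisor_chi4_sum n = (\<Sum>d | d dvd n. chi4 d)"

text \<open>
  Inclusion and exclusion: the divisors of \<open>pn\<close> are the divisors of \<open>n\<close> together with \<open>p\<close> times
  the divisors of \<open>n\<close>, and the numbers in both families are \<open>p\<close> times the divisors of \<open>n/p\<close>.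
\<close>
lemma divisor_chi4_sum_prime_mult:
  assumes p: "prime p" and n: "n > 0"
  shows "divisor_chi4_sum (p * n) = (1 + chi4 p) * divisor_chi4_sum n
           - chi4 p * (if p dvd n then divisor_chi4_sum (n div p) else 0)"
proof -
  have p0: "p > 0" using p prime_gt_0_nat by blast
  define A where "A = {d. d dvd n}"
  define B where "B = (*) p ` A"
  have fin: "finite A" "finite B" using n by (simp_all add: A_def B_def)
  have un: "{d. d dvd p * n} = A \<union> B"
  proof (intro equalityI subsetI)
    fix d assume "d \<in> {d. d dvd p * n}"
    then have d: "d dvd p * n" by simp
    show "d \<in> A \<union> B"
    proof (cases "p dvd d")
      case True
      then obtain e where "d = p * e" by (elim dvdE)
      then show ?thesis using d p0 by (auto simp: A_def B_def)
    next
      case False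
      then have "coprime d p" using p prime_imp_coprime coprime_commute by blast
      then show ?thesis using d by (simp add: A_def coprime_dvd_mult_right_iff)
    qed
  qed (auto simp: A_def B_def)
  have sB: "(\<Sum>d\<in>(*) p ` X. chi4 d) = chi4 p * (\<Sum>d\<in>X. chi4 d)" for X
    using p0 by (subst sum.reindex) (auto simp: inj_on_def chi4_mult sum_distrib_left)
  have int: "A \<inter> B = (if p dvd n then (*) p ` {d. d dvd n div p} else {})"
  proof (cases "p dvd n")
    case True
    then obtain k where "n = p * k" by (elim dvdE)
    then show ?thesis using p0 True by (auto simp: A_def B_def)
  next
    case False
    then show ?thesis by (auto simp: A_def B_def dest: dvd_mult_left)
  qed
  have "divisor_chi4_sum (p * n) = sum chi4 A + sum chi4 B - sum chi4 (A \<inter> B)"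
    unfolding divisor_chi4_sum_def un using fin by (intro sum_Un)
  also have "sum chi4 B = chi4 p * sum chi4 A" unfolding B_def by (rule sB)
  also have "sum chi4 (A \<inter> B)
      = chi4 p * (if p dvd n then divisor_chi4_sum (n div p) else 0)"
    by (simp add: int sB divisor_chi4_sum_def)
  finally show ?thesis by (simp add: A_def divisor_chi4_sum_def algebra_simps)
qed

text \<open>
  If \<open>p\<close> did not divide \<open>a\<close>, it would not divide \<open>b\<close> either; then raising \<open>a\<^sup>2 = -b\<^sup>2\<close> to the odd power \<open>(p - 1) / 2\<close> and
  applying Fermat's theorem would give \<open>1 = -1\<close> modulo \<open>p\<close>.
\<close>
lemma prime_3_mod_4_dvd_sum_squares:
  fixes a b :: int
  assumes p: "prime p" and p3: "p mod 4 = 3" and dvd: "int p dvd a\<^sup>2 + b\<^sup>2"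
  shows "int p dvd a"
proof (rule ccontr)
  assume na: "\<not> int p dvd a"
  define k where "k = (p - 1) div 2"
  have k: "2 * k = p - 1" "odd k" using p3 unfolding k_def by presburger+
  have pp: "prime (int p)" using p(1) by simp
  have fermat: "[c ^ (p - 1) = 1] (mod int p)" if "\<not> int p dvd c" for c
  proof -
    have "[nat \<bar>c\<bar> ^ (p - 1) = 1] (mod p)"
      using that p by (intro fermat_theorem) (auto simp: dvd_nat_abs_iff)
    then have "[int (nat \<bar>c\<bar> ^ (p - 1)) = int 1] (mod int p)" by (simp only: cong_int_iff)
    moreover have "even (p - 1)" using k(1) by presburger
    ultimately show ?thesis by (simp add: power_even_abs)
  qed
  have nb: "\<not> int p dvd b"
  proof
    assume "int p dvd b"
    then have "int p dvd b\<^sup>2" by (simp add: power2_eq_square)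
    then have "int p dvd a\<^sup>2" using dvd by (simp add: dvd_add_left_iff)
    then show False using na pp prime_dvd_power by blast
  qed
  have "[a\<^sup>2 = - (b\<^sup>2)] (mod int p)" using dvd by (simp add: cong_iff_dvd_diff)
  then have "[(a\<^sup>2) ^ k = (- (b\<^sup>2)) ^ k] (mod int p)" by (rule cong_pow)
  then have "[a ^ (p - 1) = - (b ^ (p - 1))] (mod int p)"
    using k by (simp flip: power_mult)
  moreover have "[- (b ^ (p - 1)) = - 1] (mod int p)"
    using fermat[OF nb] by (simp add: cong_minus_minus_iff)
  ultimately have "[1 = - 1] (mod int p)"
    using fermat[OF na] by (meson cong_sym cong_trans)
  then have "int p dvd 2" by (simp add: cong_iff_dvd_diff)
  then have "p \<le> 2" by (auto dest: zdvd_imp_le)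
  then show False using p3 by (cases p rule: nat.exhaust) auto
qed

text \<open>
  Since \<open>-1\<close> is a square modulo \<open>p\<close>, \<open>p\<close> divides \<open>x\<^sup>2 + 1 = (x + i)(x - i)\<close> for some \<open>x\<close>. The gcd
  \<open>d\<close> of \<open>p\<close> and \<open>x + i\<close> has norm \<open>p\<close>: its norm divides \<open>p\<^sup>2\<close>, norm \<open>1\<close> would make \<open>p\<close> divide \<open>x - i\<close>,
  and norm \<open>p\<^sup>2\<close> would make \<open>p\<close> divide \<open>x + i\<close>.
\<close>
lemma prime_1_mod_4_sum_squares:
  assumes p: "prime p" and p1: "p mod 4 = 1"
  obtains u v :: int where "int p = u\<^sup>2 + v\<^sup>2"
proof -
  have p2: "p > 2" using p p1 prime_gt_1_nat[of p] by (cases "p = 2") auto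
  have "even ((p - 1) div 2)" using p1 by presburger
  then have "[Legendre (-1) (int p) = 1] (mod int p)"
    using euler_criterion[of p "-1"] p p2 by simp
  moreover have "\<not> [-1 = 0] (mod int p)" "\<not> [-1 = 1] (mod int p)"
    using p2 by (auto simp: cong_iff_dvd_diff dest: zdvd_imp_le)
  ultimately have "QuadRes (int p) (-1)" by (auto simp: Legendre_def split: if_splits)
  then obtain x where "[x\<^sup>2 = -1] (mod int p)" by (auto simp: QuadRes_def)
  then have "int p dvd x\<^sup>2 + 1" by (simp add: cong_iff_dvd_diff)
  then obtain k where k: "x\<^sup>2 + 1 = int p * k" by (elim dvdE)
  define P Q where "P = Complex (of_int (int p)) (of_int 0)" and "Q = Complex (of_int x) (of_int 1)"
  have PQ: "P \<in> gauss_ints" "P \<noteq> 0" "Q \<in> gauss_ints"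
    using p2 unfolding P_def Q_def by (simp_all del: of_int_of_nat_eq of_int_0 of_int_1)
  have P: "P = of_nat p" by (simp add: P_def complex_eq_iff)
  obtain d s t c e where d: "d \<in> gauss_ints" "d \<noteq> 0" "s \<in> gauss_ints" "t \<in> gauss_ints"
      "d = s * P + t * Q" "c \<in> gauss_ints" "P = d * c" "e \<in> gauss_ints" "Q = d * e"
    using gauss_bezout[OF PQ(3,1,2)] by blast
  obtain u v where uv: "d = Complex (of_int u) (of_int v)" using d(1) by (auto simp: gauss_ints_def)
  obtain u' v' where uv': "c = Complex (of_int u') (of_int v')" using d(6) by (auto simp: gauss_ints_def)
  have nd: "(cmod d)\<^sup>2 = of_int (u\<^sup>2 + v\<^sup>2)" and nc: "(cmod c)\<^sup>2 = of_int (u'\<^sup>2 + v'\<^sup>2)"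
    by (simp_all add: uv uv' cmod_power2)
  \<comment> \<open>a multiple of \<open>p\<close> has an imaginary part divisible by \<open>p\<close>, unlike \<open>x + i\<close> and \<open>x - i\<close>\<close>
  have not_dvd: False if z: "z \<in> gauss_ints" "Im (P * z) = y" "y = 1 \<or> y = -1" for z y
  proof -
    obtain a b where "z = Complex (of_int a) (of_int b)" using z(1) by (auto simp: gauss_ints_def)
    then have "real_of_int (int p * b) = of_int 1 \<or> real_of_int (int p * b) = of_int (-1)"
      using z(2,3) by (simp add: P)
    then have "int p * b = 1 \<or> int p * b = -1" by (simp only: of_int_eq_iff)
    then have "int p * b dvd 1" by auto
    then have "int p dvd 1" by (rule dvd_mult_left)
    then show False using p2 by simp
  qed
  have "(cmod d)\<^sup>2 * (cmod c)\<^sup>2 = (cmod P)\<^sup>2" by (simp add: d(7) norm_mult power_mult_distrib)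
  also have "\<dots> = of_int ((int p)\<^sup>2)" by (simp add: P)
  finally have "real_of_int ((u\<^sup>2 + v\<^sup>2) * (u'\<^sup>2 + v'\<^sup>2)) = of_int ((int p)\<^sup>2)"
    unfolding nd nc of_int_mult .
  then have eq: "(u\<^sup>2 + v\<^sup>2) * (u'\<^sup>2 + v'\<^sup>2) = (int p)\<^sup>2" by (simp only: of_int_eq_iff)
  then have "u\<^sup>2 + v\<^sup>2 dvd (int p)\<^sup>2" by (rule dvdI[OF sym])
  then have "nat (u\<^sup>2 + v\<^sup>2) dvd p ^ 2"
    by (simp add: nat_dvd_iff)
  then obtain i where i: "i \<le> 2" "nat (u\<^sup>2 + v\<^sup>2) = p ^ i" using divides_primepow_nat[OF p] by blast
  have i': "u\<^sup>2 + v\<^sup>2 = int p ^ i"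
  proof -
    have "int (nat (u\<^sup>2 + v\<^sup>2)) = int (p ^ i)" by (simp only: i(2))
    then show ?thesis by simp
  qed
  have "i \<noteq> 0"
  proof
    assume "i = 0"
    then have "(cmod d)\<^sup>2 = 1" unfolding nd i' by simp
    then have "d \<in> gauss_units" by (rule gauss_cmod_eq_1[OF d(1)])
    then have "d * cnj d = 1" and cd: "cnj d \<in> gauss_ints"
      by (auto intro: gauss_units_norm gauss_units_cnj gauss_units_in_ints)
    then have "cnj Q = cnj d * (d * cnj Q)" by (simp add: mult.assoc[symmetric] mult.commute[of "cnj d" d])
    also have "d * cnj Q = s * P * cnj Q + t * (Q * cnj Q)" by (subst d(5)) (simp add: algebra_simps)
    also have "Q * cnj Q = of_int (x\<^sup>2 + 1)"
      by (simp add: Q_def complex_eq_iff power2_eq_square)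
    also have "\<dots> = P * of_int k" unfolding k by (simp add: P)
    finally have "cnj Q = P * (cnj d * (s * cnj Q + t * of_int k))" by (simp add: algebra_simps)
    moreover have "cnj d * (s * cnj Q + t * of_int k) \<in> gauss_ints"
      using d(3,4) cd PQ(3) by (intro gauss_ints_mult gauss_ints_add) (auto simp: gauss_ints_iff)
    moreover have "Im (cnj Q) = -1" by (simp add: Q_def)
    ultimately show False using not_dvd[of "cnj d * (s * cnj Q + t * of_int k)" "-1"] by simp
  qed
  moreover have "i \<noteq> 2"
  proof
    assume "i = 2"
    then have "u'\<^sup>2 + v'\<^sup>2 = 1" using eq p2 unfolding i' by simp
    then have "(cmod c)\<^sup>2 = 1" unfolding nc by simp
    then have "c \<in> gauss_units" by (rule gauss_cmod_eq_1[OF d(6)])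
    then have "c * cnj c = 1" and cc: "cnj c \<in> gauss_ints"
      by (auto intro: gauss_units_norm gauss_units_cnj gauss_units_in_ints)
    then have "Q = d * (c * cnj c) * e" by (simp add: d(9))
    also have "\<dots> = P * (cnj c * e)" unfolding d(7) by (simp only: mult.assoc)
    finally have "Q = P * (cnj c * e)" .
    moreover have "cnj c * e \<in> gauss_ints" using cc d(8) by (rule gauss_ints_mult)
    moreover have "Im Q = 1" by (simp add: Q_def)
    ultimately show False using not_dvd[of "cnj c * e" 1] by simp
  qed
  ultimately have "i = 1" using i(1) by linarith
  then have "int p = u\<^sup>2 + v\<^sup>2" using i' by simp
  then show ?thesis by (rule that)
qed


text \<open>
  The hypotheses say that \<open>(a + ib)(u - iv)\<close> is divisible by \<open>p = (u + iv)(u - iv)\<close>.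
\<close>
lemma gclass_dvd_of_norm_dvd:
  assumes p: "int p = u\<^sup>2 + v\<^sup>2" "p > 0" and ab: "(a, b) \<noteq> (0, 0)"
    and dvd: "int p dvd a * u + b * v" "int p dvd b * u - a * v"
  shows "gclass_of u v dvd gclass_of a b"
proof -
  have uv: "(u, v) \<noteq> (0, 0)" using p by auto
  obtain c d where c: "a * u + b * v = int p * c" and d: "b * u - a * v = int p * d"
    using dvd by (auto elim!: dvdE)
  have "int p * a = u * (a * u + b * v) - v * (b * u - a * v)"
    unfolding p(1) by (simp add: power2_eq_square algebra_simps)
  also have "\<dots> = int p * (u * c - v * d)" unfolding c d by (simp add: algebra_simps)
  finally have a: "a = u * c - v * d" using p(2) by simp
  have "int p * b = u * (b * u - a * v) + v * (a * u + b * v)"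
    unfolding p(1) by (simp add: power2_eq_square algebra_simps)
  also have "\<dots> = int p * (u * d + v * c)" unfolding c d by (simp add: algebra_simps)
  finally have b: "b = u * d + v * c" using p(2) by simp
  show ?thesis using uv ab a b by (subst gclass_of_dvd_iff) auto
qed

text \<open>
  Over the integers \<open>(au + bv)(au - bv) = p a\<^sup>2 - (a\<^sup>2 + b\<^sup>2) v\<^sup>2\<close> is divisible by \<open>p\<close>, so \<open>p\<close> divides
  one of the factors. This uses only the primality of \<open>p\<close> in the integers, and it also covers \<open>p = 2\<close>,
  for which both alternatives coincide.
\<close>
lemma split_prime_dvd:
  assumes p: "prime p" "int p = u\<^sup>2 + v\<^sup>2" and z: "gnorm z = real (p * n)"
  shows "gclass_of u v dvd z \<or> gclass_of u (- v) dvd z"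
proof -
  obtain a b where ab: "(a, b) \<noteq> (0, 0)" "z = gclass_of a b" by (rule gclass_of_cases)
  have p0: "p > 0" using p prime_gt_0_nat by blast
  have pp: "prime (int p)" using p(1) by simp
  have "real_of_int (a\<^sup>2 + b\<^sup>2) = of_int (int (p * n))" using z ab by (simp add: gnorm_gclass_of)
  then have n: "a\<^sup>2 + b\<^sup>2 = int p * int n" by (simp only: of_int_eq_iff of_nat_mult)
  have "(a * u + b * v) * (a * u - b * v) = a\<^sup>2 * (u\<^sup>2 + v\<^sup>2) - (a\<^sup>2 + b\<^sup>2) * v\<^sup>2"
    by (simp add: power2_eq_square algebra_simps)
  also have "\<dots> = int p * (a\<^sup>2 - int n * v\<^sup>2)" unfolding n p(2)[symmetric] by (simp add: algebra_simps)
  finally have "int p dvd (a * u + b * v) * (a * u - b * v)" by simp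
  then have *: "int p dvd a * u + b * v \<or> int p dvd a * u - b * v"
    using pp prime_dvd_mult_iff by blast
  have aux: "gclass_of u w dvd z" if w: "int p = u\<^sup>2 + w\<^sup>2" and d: "int p dvd a * u + b * w" for w
  proof -
    have "(b * u - a * w)\<^sup>2 = (a\<^sup>2 + b\<^sup>2) * (u\<^sup>2 + w\<^sup>2) - (a * u + b * w)\<^sup>2"
      by (simp add: power2_eq_square algebra_simps)
    also have "int p dvd \<dots>"
      using d by (intro dvd_diff) (simp_all add: n power2_eq_square[of "a * u + b * w"])
    finally have "int p dvd b * u - a * w" using pp prime_dvd_power by blast
    then show ?thesis unfolding ab(2) using w p0 ab(1) d by (intro gclass_dvd_of_norm_dvd)
  qed
  have "int p = u\<^sup>2 + (- v)\<^sup>2" using p(2) by simp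
  then show ?thesis using * aux[OF p(2)] aux[of "- v"] by auto
qed

text \<open>
  The two factors of an odd split prime are coprime. In coordinates: \<open>p\<close> divides \<open>au \<plusminus> bv\<close> and
  \<open>bu \<plusminus> av\<close>, hence \<open>2au\<close> and \<open>2bu\<close>, and it divides neither \<open>2\<close> nor \<open>u\<close>.
\<close>
lemma split_prime_both_dvd:
  assumes p: "prime p" "odd p" "int p = u\<^sup>2 + v\<^sup>2"
    and z: "gclass_of u v dvd z" "gclass_of u (- v) dvd z"
  shows "gclass_of (int p) 0 dvd z"
proof -
  obtain a b where ab: "(a, b) \<noteq> (0, 0)" "z = gclass_of a b" by (rule gclass_of_cases)
  have p0: "p > 0" using p prime_gt_0_nat by blast
  have pp: "prime (int p)" using p(1) by simp
  have uv: "(u, v) \<noteq> (0, 0)" "(u, - v) \<noteq> (0, 0)" using p p0 by auto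
  obtain c d where cd: "a = u * c - v * d" "b = u * d + v * c"
    using z(1) ab uv by (auto simp: gclass_of_dvd_iff)
  obtain c' d' where cd': "a = u * c' + v * d'" "b = u * d' - v * c'"
    using z(2) ab uv by (auto simp: gclass_of_dvd_iff)
  have "a * u + b * v = (u\<^sup>2 + v\<^sup>2) * c" "b * u - a * v = (u\<^sup>2 + v\<^sup>2) * d"
    unfolding cd by (simp_all add: power2_eq_square algebra_simps)
  then have 1: "int p dvd a * u + b * v" "int p dvd b * u - a * v" by (simp_all flip: p(3))
  have "a * u - b * v = (u\<^sup>2 + v\<^sup>2) * c'" "b * u + a * v = (u\<^sup>2 + v\<^sup>2) * d'"
    unfolding cd' by (simp_all add: power2_eq_square algebra_simps)
  then have 2: "int p dvd a * u - b * v" "int p dvd b * u + a * v" by (simp_all flip: p(3))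
  have "int p dvd 2 * (a * u)" "int p dvd 2 * (b * u)"
    using dvd_add[OF 1(1) 2(1)] dvd_add[OF 1(2) 2(2)] by simp_all
  moreover have "\<not> int p dvd 2"
  proof
    assume "int p dvd 2"
    then have "p \<le> 2" by (auto dest: zdvd_imp_le)
    then show False using p(1,2) prime_gt_1_nat[of p] by (cases "p = 2") auto
  qed
  moreover have "\<not> int p dvd u"
  proof
    assume u: "int p dvd u"
    then have "int p dvd u\<^sup>2" by (simp add: power2_eq_square)
    then have "int p dvd v\<^sup>2" using p(3) by (metis dvd_add_right_iff dvd_refl)
    then have "int p dvd v" using pp prime_dvd_power by blast
    with u have "(int p)\<^sup>2 dvd u\<^sup>2 + v\<^sup>2" by (intro dvd_add) (simp_all add: dvd_power_same)
    then have "int p * int p dvd int p * 1" unfolding p(3)[symmetric] by (simp only: power2_eq_square mult_1_right)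
    then have "int p dvd 1" using p0 by (simp only: dvd_mult_cancel_left) simp
    then show False using pp not_prime_unit by blast
  qed
  ultimately have "int p dvd a" "int p dvd b" using pp prime_dvd_mult_iff by blast+
  then show ?thesis using ab p0 by (auto simp: gclass_of_dvd_iff elim!: dvdE)
qed

definition norm_eq_count :: "nat \<Rightarrow> nat" where
  "norm_eq_count n = card {z. gnorm z = real n}"

lemma finite_gnorm_eq: "finite {z. gnorm z = r}"
  by (rule finite_subset[OF _ finite_gnorm_le[of r]]) auto

lemma gnorm_eq_multiples:
  assumes g: "gnorm g = real m" "m > 0"
  shows "{z. g dvd z \<and> gnorm z = real (m * n)} = (*) g ` {z. gnorm z = real n}"
  using assms by (auto simp: gnorm_mult elim!: dvdE)

lemma card_gnorm_eq_multiples: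
  assumes g: "gnorm g = real m" "m > 0"
  shows "card {z. g dvd z \<and> gnorm z = real (m * n)} = norm_eq_count n"
  unfolding gnorm_eq_multiples[OF assms] norm_eq_count_def by (intro card_image inj_gclass_mult)

text \<open>
  The integer \<open>p\<close> has norm \<open>p\<^sup>2\<close>, so its multiples of norm \<open>pn\<close> correspond to the classes
  of norm \<open>n/p\<close>.
\<close>
lemma card_gnorm_eq_int_multiples:
  assumes p: "p > 0"
  shows "card {z. gclass_of (int p) 0 dvd z \<and> gnorm z = real (p * n)}
           = (if p dvd n then norm_eq_count (n div p) else 0)"
proof -
  have P: "gnorm (gclass_of (int p) 0) = real (p * p)"
    using p by (simp add: gnorm_gclass_of power2_eq_square)
  show ?thesis
  proof (cases "p dvd n")
    case True
    then obtain k where k: "n = p * k" by (elim dvdE)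
    have "p * n = p * p * k" by (simp add: k)
    then show ?thesis using card_gnorm_eq_multiples[OF P, of k] p True unfolding k by (simp add: mult.assoc)
  next
    case False
    have "gnorm z \<noteq> real (p * n)" if dz: "gclass_of (int p) 0 dvd z" for z
    proof
      assume z: "gnorm z = real (p * n)"
      obtain w where w: "z = gclass_of (int p) 0 * w" using dz by (elim dvdE)
      obtain a b where ab: "(a, b) \<noteq> (0, 0)" "w = gclass_of a b" by (rule gclass_of_cases)
      have "real (p * p) * of_int (a\<^sup>2 + b\<^sup>2) = real (p * n)"
        using z unfolding w gnorm_mult P ab(2) gnorm_gclass_of[OF ab(1)] .
      then have "real_of_int (int p * (a\<^sup>2 + b\<^sup>2)) = of_int (int n)" using p by simp
      then have "int p * (a\<^sup>2 + b\<^sup>2) = int n" by (simp only: of_int_eq_iff)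
      then have "int p dvd int n" by (metis dvd_triv_left)
      then show False using False by simp
    qed
    then have "{z. gclass_of (int p) 0 dvd z \<and> gnorm z = real (p * n)} = {}" by blast
    then have "card {z. gclass_of (int p) 0 dvd z \<and> gnorm z = real (p * n)} = 0"
      by (simp only: card.empty)
    then show ?thesis using False by (simp only: if_False)
  qed
qed

text \<open>
  When \<open>p = u\<^sup>2 + v\<^sup>2\<close>, every class of norm \<open>pn\<close> is a multiple of \<open>u + iv\<close> or of \<open>u - iv\<close>, and each of
  these two families is in bijection with the classes of norm \<open>n\<close>. The common multiples are the
  multiples of \<open>p\<close> if \<open>p\<close> is odd, and the whole family if \<open>p = 2\<close>. A prime congruent to \<open>3\<close> modulo \<open>4\<close>
  is inert: every class of norm \<open>pn\<close> is a multiple of \<open>p\<close>.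
\<close>
lemma norm_eq_count_prime_mult:
  assumes p: "prime p" and n: "n > 0"
  shows "int (norm_eq_count (p * n)) = (1 + chi4 p) * int (norm_eq_count n)
           - chi4 p * (if p dvd n then int (norm_eq_count (n div p)) else 0)"
proof -
  have p0: "p > 0" using p prime_gt_0_nat by blast
  have card_union: "int (norm_eq_count (p * n)) = 2 * int (norm_eq_count n) - int (card
      {z. (gclass_of u v dvd z \<and> gclass_of u (- v) dvd z) \<and> gnorm z = real (p * n)})"
    if uv: "int p = u\<^sup>2 + v\<^sup>2" for u v
  proof -
    have g: "gnorm (gclass_of u v) = real p" "gnorm (gclass_of u (- v)) = real p"
    proof -
      have "(u, v) \<noteq> (0, 0)" "(u, - v) \<noteq> (0, 0)" using uv p0 by auto
      then have "gnorm (gclass_of u v) = of_int (u\<^sup>2 + v\<^sup>2)"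
        "gnorm (gclass_of u (- v)) = of_int (u\<^sup>2 + (- v)\<^sup>2)"
        by (simp_all only: gnorm_gclass_of not_False_eq_True)
      then show "gnorm (gclass_of u v) = real p" "gnorm (gclass_of u (- v)) = real p"
        by (simp_all only: power2_minus uv[symmetric] of_int_of_nat_eq)
    qed
    define A where "A = {z. gclass_of u v dvd z \<and> gnorm z = real (p * n)}"
    define B where "B = {z. gclass_of u (- v) dvd z \<and> gnorm z = real (p * n)}"
    have fin: "finite A" "finite B"
      by (rule finite_subset[OF _ finite_gnorm_eq[of "real (p * n)"]], auto simp: A_def B_def)+
    have "{z. gnorm z = real (p * n)} = A \<union> B"
      using split_prime_dvd[OF p uv] by (auto simp: A_def B_def)
    moreover have "A \<inter> B = {z. (gclass_of u v dvd z \<and> gclass_of u (- v) dvd z) \<and> gnorm z = real (p * n)}"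
      by (auto simp: A_def B_def)
    moreover have "card A = norm_eq_count n" "card B = norm_eq_count n"
      unfolding A_def B_def using g p0 by (simp_all only: card_gnorm_eq_multiples)
    ultimately show ?thesis
      using card_Un_Int[OF fin] by (simp add: norm_eq_count_def)
  qed
  consider "p = 2" | "p mod 4 = 1" | "p mod 4 = 3"
  proof -
    have "p = 2 \<or> odd p" using p primes_dvd_imp_eq two_is_prime_nat by blast
    moreover have "odd p \<Longrightarrow> p mod 4 = 1 \<or> p mod 4 = 3" by presburger
    ultimately show ?thesis using that by blast
  qed
  then show ?thesis
  proof cases
    case 1
    have "gclass_of 1 1 = gclass_of 1 (- 1)"
    proof (rule gclass_dvd_antisym)
      show "gclass_of 1 1 dvd gclass_of 1 (- 1)"
        by (subst gclass_of_dvd_iff) (auto intro: exI[of _ 0] exI[of _ "-1"])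
      show "gclass_of 1 (- 1) dvd gclass_of 1 1"
        by (subst gclass_of_dvd_iff) (auto intro: exI[of _ 0] exI[of _ 1])
    qed
    moreover have "gnorm (gclass_of 1 1) = real p" by (subst gnorm_gclass_of) (simp_all add: 1)
    ultimately have "card {z. (gclass_of 1 1 dvd z \<and> gclass_of 1 (- 1) dvd z) \<and> gnorm z = real (p * n)}
        = norm_eq_count n"
      using card_gnorm_eq_multiples[of "gclass_of 1 1" p n] p0 by simp
    moreover have "chi4 p = 0" by (simp add: chi4_def 1)
    ultimately show ?thesis using card_union[of 1 1] 1 by simp
  next
    case 2
    obtain u v :: int where uv: "int p = u\<^sup>2 + v\<^sup>2" using prime_1_mod_4_sum_squares[OF p 2] .
    have odd: "odd p" using 2 by presburger
    have "gclass_of u v * gclass_of u (- v) = gclass_of (int p) 0"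
      using uv p0 by (subst gclass_of_mult) (auto simp: power2_eq_square)
    then have "gclass_of u v dvd gclass_of (int p) 0" "gclass_of u (- v) dvd gclass_of (int p) 0"
      by (metis dvd_triv_left, metis dvd_triv_right)
    then have "gclass_of u v dvd z \<and> gclass_of u (- v) dvd z \<longleftrightarrow> gclass_of (int p) 0 dvd z" for z
      using split_prime_both_dvd[OF p odd uv, of z] dvd_trans by blast
    moreover have "chi4 p = 1" using 2 odd by (simp add: chi4_def)
    ultimately show ?thesis using card_union[OF uv] card_gnorm_eq_int_multiples[OF p0, of n] by simp
  next
    case 3
    have "gclass_of (int p) 0 dvd z" if z: "gnorm z = real (p * n)" for z
    proof -
      obtain a b where ab: "(a, b) \<noteq> (0, 0)" "z = gclass_of a b" by (rule gclass_of_cases)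
      have "real_of_int (a\<^sup>2 + b\<^sup>2) = of_int (int p * int n)" using z ab by (simp add: gnorm_gclass_of)
      then have "a\<^sup>2 + b\<^sup>2 = int p * int n" by (simp only: of_int_eq_iff)
      then have "int p dvd a\<^sup>2 + b\<^sup>2" "int p dvd b\<^sup>2 + a\<^sup>2" by (simp_all add: add.commute)
      then have "int p dvd a" "int p dvd b" using prime_3_mod_4_dvd_sum_squares[OF p 3] by blast+
      then show ?thesis using ab p0 by (auto simp: gclass_of_dvd_iff elim!: dvdE)
    qed
    then have "norm_eq_count (p * n) = card {z. gclass_of (int p) 0 dvd z \<and> gnorm z = real (p * n)}"
      unfolding norm_eq_count_def by (intro arg_cong[of _ _ card]) auto
    moreover have "chi4 p = -1"
    proof -
      have "odd p" using 3 by presburger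
      then show ?thesis using 3 by (simp add: chi4_def)
    qed
    ultimately show ?thesis using card_gnorm_eq_int_multiples[OF p0, of n] by simp
  qed
qed

text \<open>
  Both sides obey the same recursion at every prime, so they agree by induction on \<open>n\<close>.
\<close>
lemma norm_eq_count_eq_divisor_sum:
  "n > 0 \<Longrightarrow> int (norm_eq_count n) = divisor_chi4_sum n"
proof (induction n rule: less_induct)
  case (less n)
  show ?case
  proof (cases "n = 1")
    case True
    have "{z. gnorm z = 1} = {1}" by (auto simp: gnorm_eq_1_iff)
    moreover have "{d::nat. d dvd 1} = {1}" by auto
    ultimately show ?thesis by (simp add: True norm_eq_count_def divisor_chi4_sum_def chi4_def)
  next
    case False
    then obtain p where p: "prime p" "p dvd n" using prime_factor_nat by blast
    then obtain m where m: "n = p * m" by (elim dvdE)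
    have m0: "m > 0" "p > 1" using less.prems m p prime_gt_1_nat by (auto intro: Nat.gr0I)
    then have "m < n" by (simp add: m)
    moreover have "p dvd m \<Longrightarrow> m div p > 0 \<and> m div p < n"
      using m0 \<open>m < n\<close> by (auto simp: dvd_div_eq_0_iff dest: div_le_dividend[of m p, THEN le_less_trans])
    ultimately show ?thesis
      unfolding m norm_eq_count_prime_mult[OF p(1) m0(1)] divisor_chi4_sum_prime_mult[OF p(1) m0(1)]
      using less.IH[of m] less.IH[of "m div p"] m0(1) by (cases "p dvd m") (simp_all flip: m)
  qed
qed

section \<open>The zeta function of the Gaussian integers\<close>

lemma zeta_real_has_sum:
  assumes s: "s > 1"
  shows "((\<lambda>n. real n powr (-s)) has_sum zeta_real s) {0<..}"
proof -
  have "summable (\<lambda>n. real n powr (-s))" using s by (simp add: summable_real_powr_iff)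
  then have "summable (\<lambda>n. real (Suc n) powr (-s))" by (subst summable_Suc_iff)
  then have "(\<lambda>n. real (Suc n) powr (-s)) sums zeta_real s"
    unfolding zeta_real_def by (rule summable_sums)
  then have "((\<lambda>n. real (Suc n) powr (-s)) has_sum zeta_real s) UNIV"
    by (rule sums_nonneg_imp_has_sum) simp
  also have "?this \<longleftrightarrow> ?thesis"
    by (intro has_sum_reindex_bij_witness[of _ "\<lambda>n. n - 1" Suc]) auto
  finally show ?thesis .
qed

lemma chi4_odd: "chi4 (2 * n + 1) = (-1) ^ n"
proof (cases "even n")
  case True
  then have "(2 * n + 1) mod 4 = 1" by presburger
  then show ?thesis using True by (simp add: chi4_def)
next
  case False
  then have "(2 * n + 1) mod 4 = 3" by presburger
  then show ?thesis using False by (simp add: chi4_def)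
qed

lemma beta_real_summable:
  assumes s: "s > 1"
  shows "summable (\<lambda>n. norm ((-1) ^ n * real (2 * n + 1) powr (-s)))"
proof (rule summable_comparison_test')
  have "summable (\<lambda>n. real n powr (-s))" using s by (simp add: summable_real_powr_iff)
  then show "summable (\<lambda>n. real (Suc n) powr (-s))" by (subst summable_Suc_iff)
  show "norm (norm ((-1) ^ n * real (2 * n + 1) powr (-s))) \<le> real (Suc n) powr (-s)" for n
    using s by (auto simp: abs_mult intro!: powr_mono2')
qed

lemma beta_real_has_sum:
  assumes s: "s > 1"
  shows "((\<lambda>n. of_int (chi4 n) * real n powr (-s)) has_sum beta_real s) {0<..}"
proof -
  let ?f = "\<lambda>n. (-1) ^ n * real (2 * n + 1) powr (-s)"
  have "beta_real s = (\<Sum>n. ?f n)"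
    unfolding beta_real_def by (simp add: powr_minus divide_inverse)
  then have "?f sums beta_real s"
    using beta_real_summable[OF s] by (simp only: summable_sums summable_norm_cancel)
  then have "(?f has_sum beta_real s) UNIV"
    by (rule norm_summable_imp_has_sum[OF beta_real_summable[OF s]])
  also have "?this \<longleftrightarrow> ((\<lambda>n. of_int (chi4 n) * real n powr (-s)) has_sum beta_real s) {n. odd n}"
  proof (intro has_sum_reindex_bij_witness[of _ "\<lambda>n. n div 2" "\<lambda>n. 2 * n + 1"])
    show "of_int (chi4 (2 * n + 1)) * real (2 * n + 1) powr (-s) = ?f n" for n
      by (simp only: chi4_odd) simp
  qed auto
  also have "\<dots> \<longleftrightarrow> ?thesis"
    by (intro has_sum_cong_neutral) (auto simp: chi4_def odd_pos)
  finally show ?thesis .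
qed

lemma gnorm_is_nat: obtains n where "n > 0" "gnorm z = real n"
proof -
  obtain a b where ab: "(a, b) \<noteq> (0, 0)" "z = gclass_of a b" by (rule gclass_of_cases)
  have "a\<^sup>2 + b\<^sup>2 > 0" using ab(1) by (auto simp: sum_power2_gt_zero_iff)
  moreover have "gnorm z = of_int (a\<^sup>2 + b\<^sup>2)" unfolding ab(2) by (rule gnorm_gclass_of[OF ab(1)])
  ultimately show ?thesis by (intro that[of "nat (a\<^sup>2 + b\<^sup>2)"]) auto
qed

lemma gnorm_floor: "real (nat \<lfloor>gnorm z\<rfloor>) = gnorm z" "nat \<lfloor>gnorm z\<rfloor> > 0"
  by (rule gnorm_is_nat[of z], simp)+

lemma gnorm_zeta_by_norm:
  assumes s: "s > 1"
  shows "((\<lambda>n. real (norm_eq_count n) * real n powr (-s)) has_sum (\<Sum>\<^sub>\<infinity>z. gnorm z powr (-s))) {0<..}"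
proof -
  have "((\<lambda>z. gnorm z powr (-s)) has_sum (\<Sum>\<^sub>\<infinity>z. gnorm z powr (-s))) UNIV"
    by (rule has_sum_infsum[OF gnorm_summable_on[OF s]])
  also have "?this \<longleftrightarrow> ((\<lambda>(n, z). real n powr (-s)) has_sum (\<Sum>\<^sub>\<infinity>z. gnorm z powr (-s)))
      (SIGMA n:{0<..}. {z. gnorm z = real n})"
    by (intro has_sum_reindex_bij_witness[of _ snd "\<lambda>z. (nat \<lfloor>gnorm z\<rfloor>, z)"])
       (auto simp: gnorm_floor gnorm_ge_1 simp del: of_nat_nat)
  finally show ?thesis
    by (rule has_sum_Sigma') (auto simp: norm_eq_count_def finite_gnorm_eq intro!: has_sum_finiteI)
qed

text \<open>
  The product of the two absolutely convergent series is the sum of \<open>\<chi>(d) (dm)^(-s)\<close> over all pairs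
  \<open>(d, m)\<close>; grouping the pairs by \<open>n = dm\<close> turns them into the divisors \<open>d\<close> of \<open>n\<close>.
\<close>
lemma zeta_beta_by_divisor_sum:
  assumes s: "s > 1"
  shows "((\<lambda>n. of_int (divisor_chi4_sum n) * real n powr (-s)) has_sum (beta_real s * zeta_real s)) {0<..}"
proof -
  let ?w = "\<lambda>n. real n powr (-s)"
  define F where "F = (\<lambda>(d, m). of_int (chi4 d) * ?w (d * m))"
  have F: "F (d, m) = of_int (chi4 d) * ?w d * ?w m" for d m
    by (simp add: F_def powr_mult)
  have Z: "(?w has_sum zeta_real s) {0<..}" by (rule zeta_real_has_sum[OF s])
  have "(\<lambda>x. norm (F x)) summable_on {0<..} \<times> {0<..}"
    unfolding Infinite_Sum.abs_summable_on_Sigma_iff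
  proof (intro conjI ballI)
    have nF: "norm (F (d, m)) = norm (of_int (chi4 d) * ?w d) * ?w m" for d m
      unfolding F by (simp add: abs_mult)
    have Zs: "?w summable_on {0<..}" using Z by (rule has_sum_imp_summable)
    show "(\<lambda>m. norm (F (d, m))) summable_on {0<..}" for d
      unfolding nF by (rule summable_on_cmult_right[OF Zs])
    have "(\<lambda>d. of_int (chi4 d) * ?w d) summable_on {0<..}"
      using beta_real_has_sum[OF s] by (rule has_sum_imp_summable)
    then have "(\<lambda>d. norm (of_int (chi4 d) * ?w d)) summable_on {0<..}"
      by (subst (asm) summable_on_iff_abs_summable_on_real)
    moreover have "(\<Sum>\<^sub>\<infinity>m\<in>{0<..}. norm (F (d, m))) = norm (of_int (chi4 d) * ?w d) * zeta_real s" for d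
      unfolding nF by (rule infsumI[OF has_sum_cmult_right[OF Z]])
    then have "norm (\<Sum>\<^sub>\<infinity>m\<in>{0<..}. norm (F (d, m))) = norm (of_int (chi4 d) * ?w d) * norm (zeta_real s)" for d
      by (simp add: abs_mult)
    ultimately show "(\<lambda>d. norm (\<Sum>\<^sub>\<infinity>m\<in>{0<..}. norm (F (d, m)))) summable_on {0<..}"
      by (simp only: summable_on_cmult_left)
  qed
  then have "F summable_on {0<..} \<times> {0<..}" by (rule abs_summable_summable)
  then have "(F has_sum (beta_real s * zeta_real s)) ({0<..} \<times> {0<..})"
    using has_sum_cmult_right[OF Z] has_sum_cmult_left[OF beta_real_has_sum[OF s]]
    by (intro has_sum_SigmaI[where g = "\<lambda>d. of_int (chi4 d) * ?w d * zeta_real s"]) (simp_all only: F)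
  also have "?this \<longleftrightarrow> ((\<lambda>(n, d). of_int (chi4 d) * ?w n) has_sum (beta_real s * zeta_real s))
      (SIGMA n:{0<..}. {d. d dvd n})"
  proof (intro has_sum_reindex_bij_witness[of _ "\<lambda>(n, d). (d, n div d)" "\<lambda>(d, m). (d * m, d)"])
    show "(case p of (n, d) \<Rightarrow> (d, n div d)) \<in> {0<..} \<times> {0<..}"
      if "p \<in> (SIGMA n:{0<..}. {d. d dvd n})" for p :: "nat \<times> nat"
      using that by (cases p) (auto elim!: dvdE)
  qed (auto simp: F_def)
  finally show ?thesis
    by (rule has_sum_Sigma')
       (auto simp: divisor_chi4_sum_def sum_distrib_right intro!: has_sum_finiteI)
qed

lemma gnorm_zeta_eq:
  assumes s: "s > 1"
  shows "(\<Sum>\<^sub>\<infinity>z. gnorm z powr (-s)) = zeta_real s * beta_real s"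
proof -
  have "((\<lambda>n. real (norm_eq_count n) * real n powr (-s)) has_sum (beta_real s * zeta_real s)) {0<..}"
    using zeta_beta_by_divisor_sum[OF s]
    by (rule has_sum_cong[THEN iffD1, rotated]) (simp flip: norm_eq_count_eq_divisor_sum)
  from has_sum_unique[OF gnorm_zeta_by_norm[OF s] this] show ?thesis by (simp add: mult.commute)
qed

lemma zeta_real_2: "zeta_real 2 = pi\<^sup>2 / 6"
proof -
  have "(\<lambda>n. real (Suc n) powr (-2)) = (\<lambda>n. 1 / real ((n + 1)\<^sup>2))"
    by (simp add: powr_minus divide_inverse add.commute)
  then show ?thesis
    using sums_unique[OF inverse_squares_sums] unfolding zeta_real_def by (simp only:)
qed

text \<open>
  The partial sums of an alternating series with decreasing terms lie alternately above and below its sum.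
\<close>
lemma beta_real_2_le: "beta_real 2 \<le> 1"
proof -
  let ?a = "\<lambda>n. 1 / real (2 * n + 1) powr 2"
  have lim: "?a \<longlonglongrightarrow> 0" by real_asymp
  have mono: "?a (Suc n) \<le> ?a n" for n
    by (intro divide_left_mono powr_mono2 mult_pos_pos) auto
  have "(\<Sum>n. (-1) ^ n * ?a n) \<le> (\<Sum>i<2*0+1. (-1) ^ i * ?a i)"
    by (rule summable_Leibniz'(4)[OF lim _ mono]) simp
  then show ?thesis by (simp add: beta_real_def)
qed

text \<open>
  This bound is what makes the contraction below strict: its factor is the value of the sum minus \<open>1\<close>.
\<close>
lemma gnorm_zeta_2_less: "(\<Sum>\<^sub>\<infinity>z. gnorm z powr (-2)) < 2"
proof -
  have "pi\<^sup>2 \<le> (3.2 :: real)\<^sup>2" using pi_approx(2) by (intro power_mono) auto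
  then have "zeta_real 2 < 2" "zeta_real 2 > 0" unfolding zeta_real_2 by (simp_all add: power2_eq_square)
  moreover from this have "zeta_real 2 * beta_real 2 \<le> zeta_real 2 * 1"
    using beta_real_2_le by (intro mult_left_mono) auto
  ultimately show ?thesis unfolding gnorm_zeta_eq[of 2, simplified] by linarith
qed

section \<open>Sorting pairs by their gcd\<close>

definition coprime_count :: "real \<Rightarrow> nat" where
  "coprime_count r = card {(x, y). gnorm x \<le> r \<and> gnorm y \<le> r \<and> gclass_gcd x y = 1}"

definition gcd_pairs :: "real \<Rightarrow> gclass \<Rightarrow> (gclass \<times> gclass) set" where
  "gcd_pairs r g = {(x, y). gnorm x \<le> r \<and> gnorm y \<le> r \<and> gclass_gcd x y = g}"

lemma gcd_pairs_subset: "gcd_pairs r g \<subseteq> {z. gnorm z \<le> r} \<times> {z. gnorm z \<le> r}"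
  by (auto simp: gcd_pairs_def)

lemma finite_gcd_pairs: "finite (gcd_pairs r g)"
  by (rule finite_subset[OF gcd_pairs_subset]) (simp add: finite_gnorm_le)

text \<open>
  The bijection is multiplication of both components by \<open>g\<close>.
\<close>
lemma card_gcd_pairs: "card (gcd_pairs r g) = coprime_count (r / gnorm g)"
proof -
  have g: "gnorm g > 0" using gnorm_ge_1[of g] by linarith
  have "gcd_pairs r g = (\<lambda>(x, y). (g * x, g * y)) ` gcd_pairs (r / gnorm g) 1"
  proof (intro equalityI subsetI)
    fix p assume "p \<in> gcd_pairs r g"
    then obtain x y where p: "p = (x, y)" "gnorm x \<le> r" "gnorm y \<le> r" "gclass_gcd x y = g"
      by (auto simp: gcd_pairs_def)
    obtain x' y' where xy: "x = g * x'" "y = g * y'"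
      using gclass_gcd(1)[of x y] gclass_gcd(2)[of x y] p(4) by (auto elim!: dvdE)
    have "g * gclass_gcd x' y' = g * 1" using p(4) by (simp add: xy gclass_gcd_mult)
    then have "gclass_gcd x' y' = 1" by (simp only: gclass_mult_left_cancel)
    moreover have "gnorm x' \<le> r / gnorm g" "gnorm y' \<le> r / gnorm g"
      using p(2,3) g by (simp_all add: xy gnorm_mult field_simps)
    ultimately show "p \<in> (\<lambda>(x, y). (g * x, g * y)) ` gcd_pairs (r / gnorm g) 1"
      by (auto simp: gcd_pairs_def p(1) xy intro!: image_eqI[of _ _ "(x', y')"])
  next
    fix p assume "p \<in> (\<lambda>(x, y). (g * x, g * y)) ` gcd_pairs (r / gnorm g) 1"
    then obtain x y where "p = (g * x, g * y)" "gnorm x \<le> r / gnorm g" "gnorm y \<le> r / gnorm g"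
        "gclass_gcd x y = 1"
      by (auto simp: gcd_pairs_def)
    then show "p \<in> gcd_pairs r g"
      using g by (simp add: gcd_pairs_def gclass_gcd_mult gnorm_mult pos_le_divide_eq mult.commute)
  qed
  moreover have "inj_on (\<lambda>(x, y). (g * x, g * y)) A" for A
    by (auto simp: inj_on_def gclass_mult_left_cancel)
  ultimately show ?thesis by (simp add: card_image coprime_count_def gcd_pairs_def)
qed

lemma coprime_count_le: "coprime_count r \<le> (norm_le_count r)\<^sup>2"
proof -
  have "card (gcd_pairs r 1) \<le> card ({z. gnorm z \<le> r} \<times> {z. gnorm z \<le> r})"
    by (intro card_mono gcd_pairs_subset) (simp add: finite_gnorm_le)
  then show ?thesis
    by (simp add: coprime_count_def gcd_pairs_def norm_le_count_def card_cartesian_product power2_eq_square)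
qed

text \<open>
  Sorting all pairs of classes of norm at most \<open>r\<close> by their gcd, whose norm is again at most \<open>r\<close>; the
  remaining terms vanish.
\<close>
lemma gcd_partition:
  "((\<lambda>g. real (coprime_count (r / gnorm g))) has_sum (real (norm_le_count r))\<^sup>2) UNIV"
proof (rule has_sum_finite_neutralI)
  let ?S = "{z. gnorm z \<le> r}"
  show "finite ?S" by (rule finite_gnorm_le)
  have ne: "gnorm g \<le> r" if "(x, y) \<in> gcd_pairs r g" for x y g
  proof -
    have "g dvd x" using that gclass_gcd(1) by (auto simp: gcd_pairs_def)
    then obtain k where "x = g * k" by (elim dvdE)
    then have "gnorm x = gnorm g * gnorm k" by (simp add: gnorm_mult)
    moreover have "gnorm g * 1 \<le> gnorm g * gnorm k"
      using gnorm_ge_1[of g] gnorm_ge_1[of k] by (intro mult_left_mono) auto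
    ultimately show ?thesis using that by (simp add: gcd_pairs_def)
  qed
  show "real (coprime_count (r / gnorm g)) = 0" if "g \<in> UNIV - ?S" for g
  proof -
    have "gcd_pairs r g = {}" using ne[of _ _ g] that by auto
    then show ?thesis by (simp flip: card_gcd_pairs)
  qed
  have "?S \<times> ?S = (\<Union>g\<in>?S. gcd_pairs r g)"
  proof (intro equalityI subsetI)
    fix p assume "p \<in> ?S \<times> ?S"
    then obtain x y where p: "p = (x, y)" "p \<in> gcd_pairs r (gclass_gcd x y)"
      by (auto simp: gcd_pairs_def)
    then show "p \<in> (\<Union>g\<in>?S. gcd_pairs r g)" using ne by blast
  qed (use gcd_pairs_subset in blast)
  moreover have "card (\<Union>g\<in>?S. gcd_pairs r g) = (\<Sum>g\<in>?S. card (gcd_pairs r g))"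
    by (rule card_UN_disjoint) (simp_all add: finite_gnorm_le finite_gcd_pairs, auto simp: gcd_pairs_def)
  ultimately have "card (?S \<times> ?S) = (\<Sum>g\<in>?S. card (gcd_pairs r g))" by simp
  then have "(norm_le_count r)\<^sup>2 = (\<Sum>g\<in>?S. coprime_count (r / gnorm g))"
    by (simp add: card_cartesian_product norm_le_count_def power2_eq_square card_gcd_pairs)
  then show "(real (norm_le_count r))\<^sup>2 = (\<Sum>g\<in>?S. real (coprime_count (r / gnorm g)))"
    by (metis of_nat_power of_nat_sum)
qed simp

section \<open>A contraction argument at infinity\<close>

lemma has_sum_diff:
  fixes f g :: "'a \<Rightarrow> real"
  assumes "(f has_sum a) A" "(g has_sum b) A"
  shows "((\<lambda>x. f x - g x) has_sum (a - b)) A"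
  using has_sum_add[OF assms(1) has_sum_uminusI[OF assms(2)]] by simp

text \<open>
  One application of the contraction. Only finitely many \<open>a\<close> carry all but a small part of the weight
  \<open>q\<close>. For these, \<open>r / N a\<close> tends to infinity together with \<open>r\<close>, so the asymptotic bound \<open>s\<close> applies to
  \<open>e (r / N a)\<close>; the others are controlled by the global bound \<open>B\<close>.
\<close>
lemma renewal_step:
  fixes w N :: "'a \<Rightarrow> real" and e :: "real \<Rightarrow> real"
  assumes w: "\<And>a. a \<in> A \<Longrightarrow> w a \<ge> 0" "(w has_sum q) A"
    and N: "\<And>a. a \<in> A \<Longrightarrow> N a > 0"
    and bound: "\<And>r. r > 0 \<Longrightarrow> \<bar>e r\<bar> \<le> B"
    and summ: "\<And>r. r > 0 \<Longrightarrow> ((\<lambda>a. w a * e (r / N a)) has_sum h r) A"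
    and lim: "((\<lambda>r. e r + h r) \<longlongrightarrow> 0) at_top"
    and s: "s \<ge> 0" "\<forall>\<^sub>F r in at_top. \<bar>e r\<bar> \<le> s" and \<epsilon>: "\<epsilon> > 0"
  shows "\<forall>\<^sub>F r in at_top. \<bar>e r\<bar> \<le> q * s + \<epsilon>"
proof -
  have B: "B \<ge> 0" using bound[of 1] by simp
  \<comment> \<open>the weight outside \<open>F\<close>; adding \<open>1\<close> to \<open>B\<close> avoids division by zero\<close>
  define \<delta> where "\<delta> = \<epsilon> / (2 * (B + 1))"
  have \<delta>: "\<delta> > 0" "B * \<delta> \<le> \<epsilon> / 2" using B \<epsilon> by (simp_all add: \<delta>_def field_simps)
  obtain F where F: "finite F" "F \<subseteq> A" "dist (sum w F) q \<le> \<delta>"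
    using has_sum_finite_approximation[OF w(2) \<delta>(1)] by blast
  have "\<forall>\<^sub>F r in at_top. \<forall>a\<in>F. \<bar>e (r / N a)\<bar> \<le> s"
  proof (intro eventually_ball_finite ballI F(1))
    fix a assume "a \<in> F"
    then have "N a > 0" using F(2) N by blast
    then have "filterlim (\<lambda>r. r / N a) at_top at_top" by real_asymp
    then show "\<forall>\<^sub>F r in at_top. \<bar>e (r / N a)\<bar> \<le> s" by (rule eventually_compose_filterlim[OF s(2)])
  qed
  moreover have "\<forall>\<^sub>F r in at_top. \<bar>e r + h r\<bar> < \<epsilon> / 2"
    using tendstoD[OF lim, of "\<epsilon> / 2"] \<epsilon> by (simp add: dist_norm)
  ultimately show ?thesis
    using eventually_gt_at_top[of 0]
  proof eventually_elim
    case (elim r)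
    \<comment> \<open>a majorant that is summable by inspection: \<open>s w\<close> on \<open>F\<close>, and at least \<open>B w\<close> elsewhere\<close>
    let ?c = "\<lambda>a. s * w a + B * w a - (if a \<in> F then B * w a else 0)"
    have "((\<lambda>a. if a \<in> F then B * w a else 0) has_sum B * sum w F) A"
      using F by (intro has_sum_finite_neutralI[of F]) (auto simp: sum_distrib_left)
    then have "(?c has_sum s * q + B * q - B * sum w F) A"
      by (intro has_sum_diff has_sum_add has_sum_cmult_right w(2))
    with summ[OF elim(3)] have "norm (h r) \<le> s * q + B * q - B * sum w F"
    proof (rule norm_infsum_le)
      fix a assume a: "a \<in> A"
      have 1: "\<bar>e (r / N a)\<bar> \<le> B" using N[OF a] elim(3) by (intro bound) simp
      have "w a * \<bar>e (r / N a)\<bar> \<le> ?c a"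
      proof (cases "a \<in> F")
        case True
        then have "w a * \<bar>e (r / N a)\<bar> \<le> w a * s" using elim(1) w(1)[OF a] by (intro mult_left_mono) auto
        then show ?thesis using True by (simp add: mult.commute)
      next
        case False
        have "w a * \<bar>e (r / N a)\<bar> \<le> w a * B" using 1 w(1)[OF a] by (intro mult_left_mono) auto
        moreover have "0 \<le> s * w a" using s(1) w(1)[OF a] by simp
        ultimately show ?thesis using False by (simp add: mult.commute)
      qed
      then show "norm (w a * e (r / N a)) \<le> ?c a" using w(1)[OF a] by (simp add: abs_mult)
    qed
    also have "\<dots> = q * s + B * (q - sum w F)" by (simp add: algebra_simps)
    also have "B * (q - sum w F) \<le> B * \<delta>"
      using F(3) B by (intro mult_left_mono) (auto simp: dist_real_def)
    finally have "\<bar>h r\<bar> \<le> q * s + \<epsilon> / 2" using \<delta>(2) by simp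
    then show ?case using elim(2) by linarith
  qed
qed

text \<open>
  The infimum \<open>l\<close> of the asymptotic bounds of \<open>\<bar>e\<bar>\<close> satisfies \<open>l \<le> q l\<close>, so it vanishes because
  \<open>q < 1\<close>.
\<close>
lemma renewal_contraction:
  fixes w N :: "'a \<Rightarrow> real" and e :: "real \<Rightarrow> real"
  assumes w: "\<And>a. a \<in> A \<Longrightarrow> w a \<ge> 0" "(w has_sum q) A" and q: "q < 1"
    and N: "\<And>a. a \<in> A \<Longrightarrow> N a > 0"
    and bound: "\<And>r. r > 0 \<Longrightarrow> \<bar>e r\<bar> \<le> B"
    and summ: "\<And>r. r > 0 \<Longrightarrow> ((\<lambda>a. w a * e (r / N a)) has_sum h r) A"
    and lim: "((\<lambda>r. e r + h r) \<longlongrightarrow> 0) at_top"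
  shows "(e \<longlongrightarrow> 0) at_top"
proof -
  have q0: "q \<ge> 0" using has_sum_nonneg[OF w(2,1)] by simp
  define S where "S = {s. s \<ge> 0 \<and> (\<forall>\<^sub>F r in at_top. \<bar>e r\<bar> \<le> s)}"
  have B: "B \<ge> 0" using bound[of 1] by simp
  have "\<forall>\<^sub>F r in at_top. \<bar>e r\<bar> \<le> B"
    using eventually_gt_at_top[of 0] by eventually_elim (rule bound)
  then have "B \<in> S" using B by (simp add: S_def)
  then have ne: "S \<noteq> {}" by blast
  have bdd: "bdd_below S" by (auto simp: S_def intro: bdd_belowI[of _ 0])
  have step: "q * s + \<epsilon> \<in> S" if "s \<in> S" "\<epsilon> > 0" for s \<epsilon>
    using renewal_step[OF w N bound summ lim, of s \<epsilon>] that q0 by (simp add: S_def)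
  define l where "l = Inf S"
  have l0: "l \<ge> 0" unfolding l_def by (rule cInf_greatest[OF ne]) (simp add: S_def)
  have "l = 0"
  proof (rule ccontr)
    assume "l \<noteq> 0"
    \<comment> \<open>small enough that \<open>q (l + \<delta>) + \<delta> < l\<close>\<close>
    define \<delta> where "\<delta> = (1 - q) * l / 4"
    have \<delta>: "\<delta> > 0" using q l0 \<open>l \<noteq> 0\<close> by (simp add: \<delta>_def)
    obtain s where s: "s \<in> S" "s < l + \<delta>"
      using cInf_lessD[OF ne, of "l + \<delta>"] \<delta> by (auto simp: l_def)
    have "l \<le> q * s + \<delta>" unfolding l_def by (rule cInf_lower[OF step[OF s(1) \<delta>] bdd])
    also have "q * s \<le> q * (l + \<delta>)" using s(2) q0 by (intro mult_left_mono) auto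
    also have "q * (l + \<delta>) + \<delta> \<le> q * l + 2 * \<delta>" using q \<delta> by (simp add: algebra_simps)
    also have "q * l + 2 * \<delta> = l - 2 * \<delta>" by (simp add: \<delta>_def field_simps)
    finally show False using \<delta> by simp
  qed
  show ?thesis
  proof (rule tendstoI)
    fix \<epsilon> :: real assume "\<epsilon> > 0"
    then obtain s where "s \<in> S" "s < \<epsilon>"
      using cInf_lessD[OF ne, of \<epsilon>] \<open>l = 0\<close> by (auto simp: l_def)
    then have "\<forall>\<^sub>F r in at_top. \<bar>e r\<bar> \<le> s" by (simp add: S_def)
    then show "\<forall>\<^sub>F r in at_top. dist (e r) 0 < \<epsilon>"
      by eventually_elim (use \<open>s < \<epsilon>\<close> in simp)
  qed
qed

section \<open>The density of coprime pairs\<close>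

text \<open>
  The contraction is applied to the error \<open>e\<close>, the weights \<open>N(g)^(-2)\<close> and the indices \<open>g \<noteq> 1\<close>. The sum over
  all \<open>g\<close>, including the term \<open>e(r)\<close> for \<open>g = 1\<close>, is \<open>A(r)\<^sup>2 / r\<^sup>2 - c\<^sup>2\<close>, which tends to \<open>0\<close>.
\<close>
lemma coprime_count_asymp:
  "((\<lambda>r. real (coprime_count r) / r\<^sup>2) \<longlongrightarrow>
      quarter_disc_area\<^sup>2 / (\<Sum>\<^sub>\<infinity>z. gnorm z powr (-2))) at_top"
proof -
  define G where "G = (\<Sum>\<^sub>\<infinity>z. gnorm z powr (-2))"
  define w where "w = (\<lambda>z. gnorm z powr (-2))"
  define L where "L = quarter_disc_area\<^sup>2 / G"
  define e where "e = (\<lambda>r. real (coprime_count r) / r\<^sup>2 - L)"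
  define h where "h = (\<lambda>r. (real (norm_le_count r))\<^sup>2 / r\<^sup>2 - quarter_disc_area\<^sup>2 - e r)"
  have G: "G > 0" "G < 2" unfolding G_def using gnorm_infsum_pos[of 2] gnorm_zeta_2_less by simp_all
  have w_sum: "(w has_sum G) UNIV"
    unfolding w_def G_def using gnorm_summable_on[of 2] by (intro has_sum_infsum) simp
  have w1: "w 1 = 1" by (simp add: w_def gnorm_eq_1_iff[of 1, THEN iffD2])
  obtain K where K: "K > 0" "\<And>r. r > 0 \<Longrightarrow> real (norm_le_count r) \<le> K * r" using norm_le_count_le by blast
  have e_bound: "\<bar>e r\<bar> \<le> K\<^sup>2 + L" if r: "r > 0" for r
  proof -
    have "real (coprime_count r) \<le> (real (norm_le_count r))\<^sup>2"
      using coprime_count_le[of r] by (metis of_nat_le_iff of_nat_power)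
    also have "\<dots> \<le> (K * r)\<^sup>2" using K(2)[OF r] by (intro power_mono) auto
    finally have "real (coprime_count r) / r\<^sup>2 \<le> K\<^sup>2"
      using r by (simp add: field_simps power_mult_distrib)
    moreover have "real (coprime_count r) / r\<^sup>2 \<ge> 0" "L \<ge> 0" using G by (simp_all add: L_def)
    ultimately show ?thesis unfolding e_def using zero_le_power2[of K] by linarith
  qed
  have e_sum: "((\<lambda>g. w g * e (r / gnorm g)) has_sum h r) (UNIV - {1})" if r: "r > 0" for r
  proof -
    have "((\<lambda>g. real (coprime_count (r / gnorm g)) / r\<^sup>2) has_sum (real (norm_le_count r))\<^sup>2 / r\<^sup>2) UNIV"
      by (intro has_sum_divide_const gcd_partition)
    moreover have "((\<lambda>g. w g * L) has_sum G * L) UNIV"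
      by (intro has_sum_cmult_left w_sum)
    ultimately have "((\<lambda>g. real (coprime_count (r / gnorm g)) / r\<^sup>2 - w g * L) has_sum
        (real (norm_le_count r))\<^sup>2 / r\<^sup>2 - G * L) UNIV"
      by (rule has_sum_diff)
    moreover have "real (coprime_count (r / gnorm g)) / r\<^sup>2 - w g * L = w g * e (r / gnorm g)" for g
    proof -
      have "gnorm g > 0" using gnorm_ge_1[of g] by linarith
      then have "w g * (real (coprime_count (r / gnorm g)) / (r / gnorm g)\<^sup>2) = real (coprime_count (r / gnorm g)) / r\<^sup>2"
        using r by (simp add: w_def powr_minus divide_simps)
      then show ?thesis by (simp add: e_def right_diff_distrib)
    qed
    moreover have "G * L = quarter_disc_area\<^sup>2" using G by (simp add: L_def)
    ultimately have "((\<lambda>g. w g * e (r / gnorm g)) has_sum (real (norm_le_count r))\<^sup>2 / r\<^sup>2 - quarter_disc_area\<^sup>2) UNIV"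
      by simp
    moreover have "((\<lambda>g. w g * e (r / gnorm g)) has_sum e r) {1}"
      by (rule has_sum_finiteI) (simp_all add: w1 gnorm_eq_1_iff[of 1, THEN iffD2])
    ultimately show ?thesis unfolding h_def by (intro has_sum_Diff) auto
  qed
  have lim: "((\<lambda>r. e r + h r) \<longlongrightarrow> 0) at_top"
  proof -
    have "((\<lambda>r. (real (norm_le_count r) / r)\<^sup>2 - quarter_disc_area\<^sup>2) \<longlongrightarrow> quarter_disc_area\<^sup>2 - quarter_disc_area\<^sup>2) at_top"
      by (intro tendsto_intros norm_le_count_asymp)
    then show ?thesis by (simp add: h_def power_divide)
  qed
  have "(w has_sum G - 1) (UNIV - {1})"
    using w_sum by (intro has_sum_Diff) (auto simp: w1 intro: has_sum_finiteI)
  then have "(e \<longlongrightarrow> 0) at_top"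
  proof (rule renewal_contraction[OF _ _ _ _ e_bound e_sum lim, rotated])
    show "gnorm g > 0" for g using gnorm_ge_1[of g] by linarith
  qed (use G in \<open>auto simp: w_def\<close>)
  then show ?thesis by (simp add: e_def LIM_zero_iff L_def G_def)
qed

section \<open>Convergence in law\<close>

text \<open>
  The values of \<open>X\<close> and \<open>Y\<close> lie in \<open>S\<close> only almost surely, so the event is replaced by the finite union
  of the events \<open>X = x\<close>, \<open>Y = y\<close> over the pairs in \<open>S \<times> S\<close> with \<open>f x y = v\<close>, up to a null set.
  Countability makes the original event measurable.
\<close>
lemma (in prob_space) prob_uniform_pair:
  fixes X Y :: "'a \<Rightarrow> 'b"
  assumes indep: "indep_var (count_space UNIV) X (count_space UNIV) Y"
    and X: "distr M (count_space UNIV) X = measure_pmf (pmf_of_set S)"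
    and Y: "distr M (count_space UNIV) Y = measure_pmf (pmf_of_set S)"
    and S: "finite S" "S \<noteq> {}" and countable: "countable (UNIV :: 'b set)"
  shows "\<P>(\<omega> in M. f (X \<omega>) (Y \<omega>) = v) = real (card {(x, y) \<in> S \<times> S. f x y = v}) / (real (card S))\<^sup>2"
proof -
  have mX: "X \<in> measurable M (count_space UNIV)" and mY: "Y \<in> measurable M (count_space UNIV)"
    using indep_var_rv1[OF indep] indep_var_rv2[OF indep] by simp_all
  have mY': "(\<lambda>\<omega>. f i (Y \<omega>)) \<in> measurable M (count_space UNIV)" for i
    by (rule measurable_compose[OF mY]) simp
  have mf: "(\<lambda>\<omega>. f (X \<omega>) (Y \<omega>)) \<in> measurable M (count_space UNIV)"
    by (rule measurable_compose_countable'[OF mY' mX countable])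
  define T where "T = {(x, y) \<in> S \<times> S. f x y = v}"
  define E where "E = (\<lambda>(x, y). (\<lambda>\<omega>. (X \<omega>, Y \<omega>)) -` ({x} \<times> {y}) \<inter> space M)"
  have fin: "finite T" by (rule finite_subset[of _ "S \<times> S"]) (auto simp: T_def S)
  have point: "prob (Z -` {x} \<inter> space M) = 1 / real (card S)"
    if "x \<in> S" "Z \<in> measurable M (count_space UNIV)" "distr M (count_space UNIV) Z = measure_pmf (pmf_of_set S)" for x Z
  proof -
    have "prob (Z -` {x} \<inter> space M) = measure (distr M (count_space UNIV) Z) {x}"
      using that(2) by (simp add: measure_distr)
    also have "\<dots> = 1 / real (card S)" using that(1) S by (simp add: that(3) measure_pmf_of_set)
    finally show ?thesis .
  qed
  have E: "prob (E p) = 1 / (real (card S))\<^sup>2" if "p \<in> T" for p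
    using that indep_varD[OF indep, of "{fst p}" "{snd p}"] point[OF _ mX X] point[OF _ mY Y]
    by (auto simp: E_def T_def power2_eq_square)
  have E_sets: "E p \<in> sets M" for p
  proof -
    have "E p = (X -` {fst p} \<inter> space M) \<inter> (Y -` {snd p} \<inter> space M)"
      by (auto simp: E_def split: prod.splits)
    then show ?thesis using measurable_sets[OF mX] measurable_sets[OF mY] by simp
  qed
  have AE_S: "AE \<omega> in M. Z \<omega> \<in> S"
    if "Z \<in> measurable M (count_space UNIV)" "distr M (count_space UNIV) Z = measure_pmf (pmf_of_set S)" for Z
  proof -
    have "AE x in distr M (count_space UNIV) Z. x \<in> S" unfolding that(2) using S by (simp add: AE_measure_pmf_iff)
    then show ?thesis using that(1) by (subst (asm) AE_distr_iff) auto
  qed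
  have "\<P>(\<omega> in M. f (X \<omega>) (Y \<omega>) = v) = prob (\<Union>p\<in>T. E p)"
  proof (rule measure_eq_AE)
    show "AE \<omega> in M. \<omega> \<in> {\<omega> \<in> space M. f (X \<omega>) (Y \<omega>) = v} \<longleftrightarrow> \<omega> \<in> (\<Union>p\<in>T. E p)"
      using AE_S[OF mX X] AE_S[OF mY Y] by eventually_elim (auto simp: T_def E_def)
    show "{\<omega> \<in> space M. f (X \<omega>) (Y \<omega>) = v} \<in> sets M"
      using measurable_sets[OF mf, of "{v}"] by (simp add: vimage_def Int_def conj_commute)
    show "(\<Union>p\<in>T. E p) \<in> sets M" using fin E_sets by auto
  qed
  also have "\<dots> = (\<Sum>p\<in>T. prob (E p))"
    using fin E_sets by (intro finite_measure_finite_Union) (auto simp: disjoint_family_on_def E_def)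
  also have "\<dots> = real (card T) / (real (card S))\<^sup>2" by (simp add: E)
  finally show ?thesis by (simp add: T_def)
qed

lemma countable_gclass: "countable (UNIV :: gclass set)"
proof -
  have "countable (range (\<lambda>(a, b). gclass_of (int a) (int (Suc b))))" by simp
  then show ?thesis by (simp only: bij_betw_imp_surj_on[OF bij_betw_quadrant])
qed

theorem mainTheorem3:
  fixes M :: "nat \<Rightarrow> 'm measure"
    and X Y :: "nat \<Rightarrow> 'm \<Rightarrow> gclass"
  assumes "\<And>n. n \<ge> 1 \<Longrightarrow> prob_space (M n)"
    and "\<And>n. n \<ge> 1 \<Longrightarrow>
           prob_space.indep_var (M n) (count_space UNIV) (X n) (count_space UNIV) (Y n)"
    and "\<And>n. n \<ge> 1 \<Longrightarrow>
           distr (M n) (count_space UNIV) (X n) = pmf_of_set {z. gnorm z \<le> (real n)\<^sup>2}"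
    and "\<And>n. n \<ge> 1 \<Longrightarrow>
           distr (M n) (count_space UNIV) (Y n) = pmf_of_set {z. gnorm z \<le> (real n)\<^sup>2}"
  shows "converges_in_law M (\<lambda>n \<omega>. gclass_gcd (X n \<omega>) (Y n \<omega>)) (gclass_zeta 2)
       \<and> (\<lambda>n. \<P>(\<omega> in M n. gclass_gcd (X n \<omega>) (Y n \<omega>) = 1))
           \<longlonglongrightarrow> inverse (\<Sum>\<^sub>\<infinity>z. gnorm z powr (-2))
       \<and> inverse (\<Sum>\<^sub>\<infinity>z. gnorm z powr (-2)) = 1 / (zeta_real 2 * beta_real 2)"
proof -
  let ?G = "\<Sum>\<^sub>\<infinity>z. gnorm z powr (-2)"
  have prob: "\<P>(\<omega> in M n. gclass_gcd (X n \<omega>) (Y n \<omega>) = g)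
      = real (coprime_count ((real n)\<^sup>2 / gnorm g)) / (real (norm_le_count ((real n)\<^sup>2)))\<^sup>2" if n: "n \<ge> 1" for n g
  proof -
    interpret prob_space "M n" by (rule assms(1)[OF n])
    have "\<P>(\<omega> in M n. gclass_gcd (X n \<omega>) (Y n \<omega>) = g) = real (card {(x, y) \<in>
          {z. gnorm z \<le> (real n)\<^sup>2} \<times> {z. gnorm z \<le> (real n)\<^sup>2}. gclass_gcd x y = g})
        / (real (card {z. gnorm z \<le> (real n)\<^sup>2}))\<^sup>2"
      using n by (intro prob_uniform_pair assms(2-4) finite_gnorm_le gnorm_le_nonempty countable_gclass) simp_all
    also have "{(x, y) \<in> {z. gnorm z \<le> (real n)\<^sup>2} \<times> {z. gnorm z \<le> (real n)\<^sup>2}. gclass_gcd x y = g}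
        = gcd_pairs ((real n)\<^sup>2) g"
      by (auto simp: gcd_pairs_def)
    finally show ?thesis by (simp add: card_gcd_pairs norm_le_count_def)
  qed
  have lim: "(\<lambda>n. \<P>(\<omega> in M n. gclass_gcd (X n \<omega>) (Y n \<omega>) = g)) \<longlonglongrightarrow> inverse ?G * gnorm g powr (-2)" for g
  proof -
    have g: "gnorm g > 0" using gnorm_ge_1[of g] by linarith
    have sq: "filterlim (\<lambda>n. (real n)\<^sup>2) at_top sequentially" by real_asymp
    have sqg: "filterlim (\<lambda>n. (real n)\<^sup>2 / gnorm g) at_top sequentially" using g by real_asymp
    have "(\<lambda>n. gnorm g powr (-2) *
          (real (coprime_count ((real n)\<^sup>2 / gnorm g)) / ((real n)\<^sup>2 / gnorm g)\<^sup>2) /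
          (real (norm_le_count ((real n)\<^sup>2)) / (real n)\<^sup>2)\<^sup>2)
        \<longlonglongrightarrow> gnorm g powr (-2) * (quarter_disc_area\<^sup>2 / ?G) / quarter_disc_area\<^sup>2"
      using quarter_disc_area_pos
      by (intro tendsto_intros filterlim_compose[OF coprime_count_asymp sqg] filterlim_compose[OF norm_le_count_asymp sq]) simp
    also have "gnorm g powr (-2) * (quarter_disc_area\<^sup>2 / ?G) / quarter_disc_area\<^sup>2 = inverse ?G * gnorm g powr (-2)"
      using quarter_disc_area_pos by (simp add: field_simps)
    finally show ?thesis
    proof (rule Lim_transform_eventually)
      show "\<forall>\<^sub>F n in sequentially. gnorm g powr (-2) *
          (real (coprime_count ((real n)\<^sup>2 / gnorm g)) / ((real n)\<^sup>2 / gnorm g)\<^sup>2) /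
          (real (norm_le_count ((real n)\<^sup>2)) / (real n)\<^sup>2)\<^sup>2
        = \<P>(\<omega> in M n. gclass_gcd (X n \<omega>) (Y n \<omega>) = g)"
        using eventually_ge_at_top[of 1]
      proof eventually_elim
        case (elim n)
        then show ?case using g by (simp add: prob powr_minus field_simps)
      qed
    qed
  qed
  have "converges_in_law M (\<lambda>n \<omega>. gclass_gcd (X n \<omega>) (Y n \<omega>)) (gclass_zeta 2)"
    using lim by (simp add: converges_in_law_def pmf_gclass_zeta)
  moreover have "(\<lambda>n. \<P>(\<omega> in M n. gclass_gcd (X n \<omega>) (Y n \<omega>) = 1)) \<longlonglongrightarrow> inverse ?G"
    using lim[of 1] by (simp add: gnorm_eq_1_iff[of 1, THEN iffD2])
  moreover have "inverse ?G = 1 / (zeta_real 2 * beta_real 2)"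
    using gnorm_zeta_eq[of 2] by (simp add: divide_inverse)
  ultimately show ?thesis by blast
qed

end
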